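(* Let $E$ be a complex Hilbert space and let $\varphi: E\to E$ be a mapping. Then the composition operator $C_{\varphi}$ is bounded on $\mathcal{H}(E)$ if and only if $\varphi(z)=Az+b$ for all $z\in E$, where $A$ is a linear operator on $E$ with $\|A\|\leq 1$ and $b\in E$ is a vector such that $A^{*}b$ belongs to the range of $(I-A^{*}A)^{1/2}$. Furthermore, in this case the norm of $C_{\varphi}$ is given by $$\|C_{\varphi}\| = \exp\Big(\frac{1}{2}\|v\|^2+\frac{1}{2}\|b\|^2\Big),$$ where $v$ is the unique vector in $E$ of minimum norm that satisfies the equation $A^{*}b=(I-A^{*}A)^{1/2}v$.
   Context: Inner products are linear in the first variable. $E$ is an arbitrary complex Hilbert space (of any dimension). $\mathcal{H}(E)$ denotes the Segal-Bargmann (Fock) space over $E$: the reproducing kernel Hilbert space of functions on $E$ with kernel $K(z,w)=\exp(\langle z,w\rangle)$, $z,w\in E$. Concretely, let $E^{0}=\mathbb{C}$, let $E^{m}$ ($m\ge 1$) be the closed subspace of symmetric tensors in the Hilbert space tensor product $E^{\otimes m}$, and write $z^{m}=z\otimes\cdots\otimes z\in E^{m}$ ($z^0=1$); then $\mathcal{H}(E)$ consists of the functions $f(z)=\sum_{j=0}^{\infty}\langle z^{j},a_j\rangle$ with $a_j\in E^{j}$ and $\|f\|^2=\sum_{j=0}^\infty j!\,\|a_j\|^2<\infty$. No regularity is assumed on the mapping $\varphi$. The composition operator $C_\varphi$ is defined by $C_\varphi h=h\circ\varphi$ for all $h\in\mathcal{H}(E)$ for which $h\circ\varphi\in\mathcal{H}(E)$;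 that $C_\varphi$ is bounded on $\mathcal{H}(E)$ means that $h\circ\varphi\in\mathcal{H}(E)$ for every $h\in\mathcal{H}(E)$ and that $C_\varphi:\mathcal{H}(E)\to\mathcal{H}(E)$ is a bounded linear operator. For a positive operator $T$, $T^{1/2}$ is its positive square root. *)

theory Defs
  imports "HOL-Analysis.Analysis"
begin

class complex_vector = real_vector +
  fixes scaleC :: "complex \<Rightarrow> 'a \<Rightarrow> 'a"  (infixr "*\<^sub>C" 75)
  assumes scaleC_add_right: "c *\<^sub>C (x + y) = c *\<^sub>C x + c *\<^sub>C y"
    and scaleC_add_left: "(c + d) *\<^sub>C x = c *\<^sub>C x + d *\<^sub>C x"
    and scaleC_scaleC: "c *\<^sub>C d *\<^sub>C x = (c * d) *\<^sub>C x"
    and scaleC_one: "1 *\<^sub>C x = x"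
    and scaleR_scaleC: "r *\<^sub>R x = complex_of_real r *\<^sub>C x"

text \<open>
  The complex inner product is linear in the first variable. Its real part is the inner product of
  the underlying real inner product space, so positive definiteness and the identity
  \<open>norm x ^ 2 = Re (cinner x x)\<close> are inherited from \<^class>\<open>real_inner\<close>; that \<open>cinner x x\<close> is real
  follows from conjugate symmetry.
\<close>

class complex_inner = complex_vector + real_inner +
  fixes cinner :: "'a \<Rightarrow> 'a \<Rightarrow> complex"
  assumes cinner_commute: "cinner x y = cnj (cinner y x)"
    and cinner_add_left: "cinner (x + y) z = cinner x z + cinner y z"
    and cinner_scaleC_left: "cinner (c *\<^sub>C x) y = c * cinner x y"
    and Re_cinner: "Re (cinner x y) = inner x y"

class complex_hilbert_space = complex_inner + complete_space

instantiation complex :: complex_hilbert_space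
begin

definition scaleC_complex :: "complex \<Rightarrow> complex \<Rightarrow> complex"
  where "scaleC_complex c x = c * x"

definition cinner_complex :: "complex \<Rightarrow> complex \<Rightarrow> complex"
  where "cinner_complex x y = x * cnj y"

instance
  by standard
    (auto simp: scaleC_complex_def cinner_complex_def algebra_simps scaleR_conv_of_real
      inner_complex_def)

end


definition bounded_clinear :: "('a::complex_inner \<Rightarrow> 'a) \<Rightarrow> bool"
  where "bounded_clinear A \<longleftrightarrow> bounded_linear A \<and> (\<forall>c x. A (c *\<^sub>C x) = c *\<^sub>C A x)"

definition cadjoint :: "('a::complex_inner \<Rightarrow> 'a) \<Rightarrow> 'a \<Rightarrow> 'a"
  where "cadjoint A = (THE B. \<forall>x y. cinner (A x) y = cinner x (B y))"

definition positive_operator :: "('a::complex_inner \<Rightarrow> 'a) \<Rightarrow> bool"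
  where "positive_operator T \<longleftrightarrow> bounded_clinear T \<and> (\<forall>x. cinner (T x) x \<in> \<real>\<^sub>\<ge>\<^sub>0)"

definition operator_sqrt :: "('a::complex_inner \<Rightarrow> 'a) \<Rightarrow> 'a \<Rightarrow> 'a"
  where "operator_sqrt T = (THE S. positive_operator S \<and> S \<circ> S = T)"


text \<open>
  A reproducing kernel Hilbert space on \<open>'x\<close> with kernel \<open>K\<close> is a set \<open>H\<close> of functions with
  an inner product \<open>ip\<close> on it. By the Moore-Aronszajn theorem such \<open>H\<close>, and the values of \<open>ip\<close>
  on \<open>H\<close>, are uniquely determined by \<open>K\<close>.
\<close>

definition ip_norm :: "(('x \<Rightarrow> complex) \<Rightarrow> ('x \<Rightarrow> complex) \<Rightarrow> complex) \<Rightarrow> ('x \<Rightarrow> complex) \<Rightarrow> real"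
  where "ip_norm ip f = sqrt (Re (ip f f))"

locale reproducing_kernel_hilbert_space =
  fixes H :: "('x \<Rightarrow> complex) set"
    and ip :: "('x \<Rightarrow> complex) \<Rightarrow> ('x \<Rightarrow> complex) \<Rightarrow> complex"
    and K :: "'x \<Rightarrow> 'x \<Rightarrow> complex"
  assumes zero_mem: "(\<lambda>x. 0) \<in> H"
    and add_mem: "f \<in> H \<Longrightarrow> g \<in> H \<Longrightarrow> (\<lambda>x. f x + g x) \<in> H"
    and scale_mem: "f \<in> H \<Longrightarrow> (\<lambda>x. c * f x) \<in> H"
    and ip_commute: "f \<in> H \<Longrightarrow> g \<in> H \<Longrightarrow> ip f g = cnj (ip g f)"
    and ip_add_left: "f \<in> H \<Longrightarrow> g \<in> H \<Longrightarrow> h \<in> H \<Longrightarrow> ip (\<lambda>x. f x + g x) h = ip f h + ip g h"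
    and ip_scale_left: "f \<in> H \<Longrightarrow> g \<in> H \<Longrightarrow> ip (\<lambda>x. c * f x) g = c * ip f g"
    and ip_nonneg: "f \<in> H \<Longrightarrow> 0 \<le> Re (ip f f)"
    and ip_definite: "f \<in> H \<Longrightarrow> ip f f = 0 \<Longrightarrow> f = (\<lambda>x. 0)"
    and complete: "(\<And>n. F n \<in> H) \<Longrightarrow>
        (\<And>e. e > 0 \<Longrightarrow> \<exists>N. \<forall>m\<ge>N. \<forall>n\<ge>N. ip_norm ip (\<lambda>x. F m x - F n x) < e) \<Longrightarrow>
        \<exists>g\<in>H. (\<lambda>n::nat. ip_norm ip (\<lambda>x. F n x - g x)) \<longlonglongrightarrow> 0"
    and kernel_mem: "(\<lambda>z. K z w) \<in> H"
    and reproducing: "f \<in> H \<Longrightarrow> f w = ip f (\<lambda>z. K z w)"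

definition segal_bargmann_space ::
    "('a::complex_hilbert_space \<Rightarrow> complex) set \<Rightarrow>
      (('a \<Rightarrow> complex) \<Rightarrow> ('a \<Rightarrow> complex) \<Rightarrow> complex) \<Rightarrow> bool"
  where "segal_bargmann_space H ip \<longleftrightarrow>
    reproducing_kernel_hilbert_space H ip (\<lambda>z w. exp (cinner z w))"

definition composition_operator :: "('x \<Rightarrow> 'x) \<Rightarrow> ('x \<Rightarrow> complex) \<Rightarrow> 'x \<Rightarrow> complex"
  where "composition_operator \<phi> h = h \<circ> \<phi>"

definition bounded_operator_on ::
    "('x \<Rightarrow> complex) set \<Rightarrow> (('x \<Rightarrow> complex) \<Rightarrow> ('x \<Rightarrow> complex) \<Rightarrow> complex) \<Rightarrow>
      (('x \<Rightarrow> complex) \<Rightarrow> 'x \<Rightarrow> complex) \<Rightarrow> bool"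
  where "bounded_operator_on H ip T \<longleftrightarrow>
    (\<forall>f\<in>H. T f \<in> H) \<and>
    (\<forall>f\<in>H. \<forall>g\<in>H. T (\<lambda>x. f x + g x) = (\<lambda>x. T f x + T g x)) \<and>
    (\<forall>c. \<forall>f\<in>H. T (\<lambda>x. c * f x) = (\<lambda>x. c * T f x)) \<and>
    (\<exists>M. \<forall>f\<in>H. ip_norm ip (T f) \<le> M * ip_norm ip f)"

definition operator_norm_on ::
    "('x \<Rightarrow> complex) set \<Rightarrow> (('x \<Rightarrow> complex) \<Rightarrow> ('x \<Rightarrow> complex) \<Rightarrow> complex) \<Rightarrow>
      (('x \<Rightarrow> complex) \<Rightarrow> 'x \<Rightarrow> complex) \<Rightarrow> real"
  where "operator_norm_on H ip T = (SUP f\<in>{f \<in> H. ip_norm ip f \<le> 1}. ip_norm ip (T f))"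


definition defect_operator :: "('a::complex_inner \<Rightarrow> 'a) \<Rightarrow> 'a \<Rightarrow> 'a"
  where "defect_operator A = operator_sqrt (\<lambda>x. x - cadjoint A (A x))"

definition admissible_symbol ::
    "('a::complex_inner \<Rightarrow> 'a) \<Rightarrow> ('a \<Rightarrow> 'a) \<Rightarrow> 'a \<Rightarrow> bool"
  where "admissible_symbol \<phi> A b \<longleftrightarrow>
    (\<forall>z. \<phi> z = A z + b) \<and> bounded_clinear A \<and> onorm A \<le> 1 \<and>
    cadjoint A b \<in> range (defect_operator A)"

end

theory Submission
  imports Defs "HOL-Library.Function_Algebras" "HOL-Complex_Analysis.Cauchy_Integral_Formula"
begin

text \<open>
  If \<open>C\<^sub>\<phi>\<close> is bounded with norm \<open>N\<close>, evaluating \<open>K(\<cdot>, \<phi> z) \<circ> \<phi>\<close> at \<open>z\<close> gives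
  \<open>\<parallel>\<phi> z\<parallel>\<^sup>2 \<le> \<parallel>z\<parallel>\<^sup>2 + 2 ln N\<close>. As \<open>\<langle>\<cdot>, a\<rangle>\<close> belongs to the space, \<open>\<langle>\<phi> z, a\<rangle>\<close> is entire of linear
  growth on every complex line, so Liouville's theorem makes \<open>\<phi>\<close> affine, \<open>\<phi> z = A z + b\<close>, with
  \<open>\<parallel>A\<parallel> \<le> 1\<close>. With \<open>D = (I - A\<^sup>*A)\<^sup>1\<^sup>/\<^sup>2\<close> the growth bound then reads
  \<open>2 Re \<langle>z, A\<^sup>*b\<rangle> \<le> \<parallel>D z\<parallel>\<^sup>2 + R\<close>, \<open>R = 2 ln N - \<parallel>b\<parallel>\<^sup>2\<close>; rescaling \<open>z\<close> yields
  \<open>\<bar>\<langle>z, A\<^sup>*b\<rangle>\<bar>\<^sup>2 \<le> R \<parallel>D z\<parallel>\<^sup>2\<close>, and the Riesz theorem produces \<open>v\<close> with \<open>D v = A\<^sup>*b\<close> and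
  \<open>\<parallel>v\<parallel>\<^sup>2 \<le> R\<close>. This is at once the range condition and the lower bound for the norm.
  Conversely, for any such \<open>v\<close> and \<open>M\<^sup>2 = exp (\<parallel>v\<parallel>\<^sup>2 + \<parallel>b\<parallel>\<^sup>2)\<close>, the kernel \<open>M\<^sup>2 K - K \<circ> (\<phi> \<times> \<phi>)\<close> is
  positive semidefinite by the Schur product theorem, which gives \<open>\<parallel>C\<^sub>\<phi>\<parallel> \<le> M\<close>.
\<close>

section \<open>Hilbert spaces carried by a subspace\<close>

text \<open>The carrier is a subspace \<open>V\<close> of a larger type so that one development
  serves both \<open>E\<close>, with \<open>V = UNIV\<close>, and a space \<open>H\<close> inside
  the type of all functions; \<open>ip\<close> is constrained on \<open>V\<close> only.\<close>

locale hilbert_subspace = vector_space scale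
  for scale :: "complex \<Rightarrow> 'v::ab_group_add \<Rightarrow> 'v" (infixr "\<odot>" 75) +
  fixes V :: "'v set" and ip :: "'v \<Rightarrow> 'v \<Rightarrow> complex"
  assumes subspace: "subspace V"
    and ip_commute: "u \<in> V \<Longrightarrow> v \<in> V \<Longrightarrow> ip u v = cnj (ip v u)"
    and ip_add_left: "u \<in> V \<Longrightarrow> v \<in> V \<Longrightarrow> w \<in> V \<Longrightarrow> ip (u + v) w = ip u w + ip v w"
    and ip_scale_left: "u \<in> V \<Longrightarrow> v \<in> V \<Longrightarrow> ip (c \<odot> u) v = c * ip u v"
    and ip_nonneg: "u \<in> V \<Longrightarrow> 0 \<le> Re (ip u u)"
    and ip_definite: "u \<in> V \<Longrightarrow> ip u u = 0 \<Longrightarrow> u = 0"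
    and complete: "(\<And>n. X n \<in> V) \<Longrightarrow>
        (\<And>e. e > 0 \<Longrightarrow> \<exists>N. \<forall>m\<ge>N. \<forall>n\<ge>N. sqrt (Re (ip (X m - X n) (X m - X n))) < e) \<Longrightarrow>
        \<exists>p\<in>V. (\<lambda>n::nat. sqrt (Re (ip (X n - p) (X n - p)))) \<longlonglongrightarrow> 0"
begin

section \<open>Norm, Cauchy-Schwarz, continuity of the inner product, Riesz and Schur\<close>

definition nrm :: "'v \<Rightarrow> real"
  where "nrm u = sqrt (Re (ip u u))"

lemmas mem_simps [simp, intro] =
  subspace_0[OF subspace] subspace_add[OF subspace] subspace_diff[OF subspace]
  subspace_scale[OF subspace]

lemma mem_sum [simp, intro]: "(\<And>i. i \<in> S \<Longrightarrow> f i \<in> V) \<Longrightarrow> sum f S \<in> V"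
  using subspace by (rule subspace_sum)

lemma ip_add_right: "u \<in> V \<Longrightarrow> v \<in> V \<Longrightarrow> w \<in> V \<Longrightarrow> ip u (v + w) = ip u v + ip u w"
  by (metis ip_add_left ip_commute mem_simps(2) complex_cnj_add)

lemma ip_scale_right: "u \<in> V \<Longrightarrow> v \<in> V \<Longrightarrow> ip u (c \<odot> v) = cnj c * ip u v"
  by (metis ip_scale_left ip_commute mem_simps(4) complex_cnj_mult)

lemma ip_zero_left: "u \<in> V \<Longrightarrow> ip 0 u = 0"
  using ip_scale_left[of 0 u 0] by simp

lemma ip_zero_right: "u \<in> V \<Longrightarrow> ip u 0 = 0"
  using ip_scale_right[of u 0 0] by simp

lemma ip_diff_left: "u \<in> V \<Longrightarrow> v \<in> V \<Longrightarrow> w \<in> V \<Longrightarrow> ip (u - v) w = ip u w - ip v w"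
  using ip_add_left[of "u - v" v w] by simp

lemma ip_diff_right: "u \<in> V \<Longrightarrow> v \<in> V \<Longrightarrow> w \<in> V \<Longrightarrow> ip u (v - w) = ip u v - ip u w"
  using ip_add_right[of u "v - w" w] by simp

lemma ip_sum_left:
  "(\<And>i. i \<in> S \<Longrightarrow> f i \<in> V) \<Longrightarrow> u \<in> V \<Longrightarrow> ip (sum f S) u = (\<Sum>i\<in>S. ip (f i) u)"
  by (induction S rule: infinite_finite_induct) (auto simp: ip_zero_left ip_add_left)

lemma ip_sum_right:
  "(\<And>i. i \<in> S \<Longrightarrow> f i \<in> V) \<Longrightarrow> u \<in> V \<Longrightarrow> ip u (sum f S) = (\<Sum>i\<in>S. ip u (f i))"
  by (induction S rule: infinite_finite_induct) (auto simp: ip_zero_right ip_add_right)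

lemmas ip_simps =
  ip_add_left ip_add_right ip_diff_left ip_diff_right ip_scale_left ip_scale_right
  ip_zero_left ip_zero_right

lemma nrm_nonneg [simp]: "u \<in> V \<Longrightarrow> 0 \<le> nrm u"
  by (simp add: nrm_def ip_nonneg)

lemma nrm_sq: "u \<in> V \<Longrightarrow> (nrm u)\<^sup>2 = Re (ip u u)"
  by (simp add: nrm_def ip_nonneg)

lemma ip_self: "u \<in> V \<Longrightarrow> ip u u = of_real ((nrm u)\<^sup>2)"
  using ip_nonneg[of u] ip_commute[of u u] by (auto simp: nrm_def complex_eq_iff)

lemma nrm_zero [simp]: "nrm 0 = 0"
  by (simp add: nrm_def ip_zero_left)

lemma nrm_eq_0_iff: "u \<in> V \<Longrightarrow> nrm u = 0 \<longleftrightarrow> u = 0"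
  using ip_self[of u] ip_definite[of u] by auto

lemma nrm_scale: "u \<in> V \<Longrightarrow> nrm (c \<odot> u) = cmod c * nrm u"
proof -
  assume u: "u \<in> V"
  have "of_real ((nrm (c \<odot> u))\<^sup>2) = (of_real ((cmod c)\<^sup>2) * of_real ((nrm u)\<^sup>2) :: complex)"
    using u by (simp add: ip_self[symmetric] ip_simps complex_norm_square mult.commute mult.left_commute
        del: of_real_power)
  then have "(nrm (c \<odot> u))\<^sup>2 = (cmod c * nrm u)\<^sup>2"
    by (simp add: power_mult_distrib flip: of_real_mult of_real_power)
  then show ?thesis using u by simp
qed

lemma nrm_diff_sq:
  "u \<in> V \<Longrightarrow> v \<in> V \<Longrightarrow> (nrm (u - v))\<^sup>2 = (nrm u)\<^sup>2 + (nrm v)\<^sup>2 - 2 * Re (ip u v)"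
  using ip_commute[of v u] nrm_sq[of "u - v"]
  by (simp add: ip_diff_left ip_diff_right nrm_sq)

lemma parallelogram:
  "u \<in> V \<Longrightarrow> v \<in> V \<Longrightarrow>
    (nrm (u - v))\<^sup>2 = 2 * (nrm u)\<^sup>2 + 2 * (nrm v)\<^sup>2 - (nrm (u + v))\<^sup>2"
  using ip_commute[of v u] nrm_sq[of "u + v"] nrm_diff_sq[of u v]
  by (simp add: ip_add_left ip_add_right nrm_sq)

text \<open>Pythagoras for the component along \<open>e\<close>. For \<open>e = 0\<close> the
  convention \<open>x / 0 = 0\<close> turns both sides into \<open>(nrm u)^2\<close>.\<close>

lemma nrm_sub_projection_sq:
  assumes "u \<in> V" "e \<in> V"
  shows "(nrm (u - (ip u e / ip e e) \<odot> e))\<^sup>2 = (nrm u)\<^sup>2 - (cmod (ip u e))\<^sup>2 / (nrm e)\<^sup>2"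
proof (cases "e = 0")
  case False
  then have n: "nrm e \<noteq> 0" using assms by (simp add: nrm_eq_0_iff)
  let ?t = "ip u e / ip e e"
  have "ip u (?t \<odot> e) = (cmod (ip u e))\<^sup>2 / (nrm e)\<^sup>2"
    using assms by (simp add: ip_simps ip_self complex_norm_square mult.commute del: of_real_power)
  moreover have "nrm (?t \<odot> e) = cmod (ip u e) / nrm e"
    using assms n by (simp add: nrm_scale ip_self norm_divide power2_eq_square norm_mult)
  ultimately show ?thesis
    using assms by (simp add: nrm_diff_sq power_divide
        flip: of_real_power of_real_divide)
qed (use assms in \<open>simp add: ip_simps\<close>)

lemma cauchy_schwarz: 
  assumes "u \<in> V" "v \<in> V"
  shows "cmod (ip u v) \<le> nrm u * nrm v"
proof (cases "v = 0")
  case False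
  then have n: "nrm v > 0" using assms nrm_nonneg[of v] nrm_eq_0_iff[of v] by linarith
  have "(cmod (ip u v))\<^sup>2 / (nrm v)\<^sup>2 \<le> (nrm u)\<^sup>2"
    using nrm_sub_projection_sq[OF assms] zero_le_power2[of "nrm (u - (ip u v / ip v v) \<odot> v)"]
    by linarith
  then have "(cmod (ip u v))\<^sup>2 \<le> (nrm u * nrm v)\<^sup>2"
    using n by (simp add: power_mult_distrib divide_simps)
  then show ?thesis using assms by (simp add: power2_le_iff_abs_le)
qed (use assms in \<open>simp add: ip_simps\<close>)

lemma tendsto_ip_right:
  assumes "\<And>s. q s \<in> V" "p \<in> V" "u \<in> V" "((\<lambda>s. nrm (q s - p)) \<longlongrightarrow> 0) F"
  shows "((\<lambda>s. ip u (q s)) \<longlongrightarrow> ip u p) F"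
proof -
  have "((\<lambda>s. nrm u * nrm (q s - p)) \<longlongrightarrow> 0) F"
    using tendsto_mult_right_zero[OF assms(4)] .
  then have "((\<lambda>s. ip u (q s) - ip u p) \<longlongrightarrow> 0) F"
    by (rule Lim_null_comparison[rotated])
      (use assms cauchy_schwarz in \<open>auto simp: ip_diff_right[symmetric] intro!: always_eventually\<close>)
  then show ?thesis by (simp add: LIM_zero_iff)
qed

lemma tendsto_ip_left:
  assumes "\<And>s. q s \<in> V" "p \<in> V" "u \<in> V" "((\<lambda>s. nrm (q s - p)) \<longlongrightarrow> 0) F"
  shows "((\<lambda>s. ip (q s) u) \<longlongrightarrow> ip p u) F"
  using tendsto_cnj[OF tendsto_ip_right[OF assms]] assms by (simp add: ip_commute[symmetric])

lemma nrm_triangle: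
  assumes "u \<in> V" "v \<in> V"
  shows "nrm (u - v) \<le> nrm u + nrm v"
proof -
  have "- Re (ip u v) \<le> nrm u * nrm v"
    using cauchy_schwarz[OF assms] abs_Re_le_cmod[of "ip u v"] by linarith
  then have "(nrm (u - v))\<^sup>2 \<le> (nrm u + nrm v)\<^sup>2"
    using assms by (simp add: nrm_diff_sq power2_sum)
  then show ?thesis using assms by (simp add: power2_le_iff_abs_le)
qed

lemma tendsto_nrm:
  assumes "\<And>s. q s \<in> V" "p \<in> V" "((\<lambda>s. nrm (q s - p)) \<longlongrightarrow> 0) F"
  shows "((\<lambda>s. nrm (q s)) \<longlongrightarrow> nrm p) F"
proof -
  have "norm (nrm (q s) - nrm p) \<le> nrm (q s - p)" for s
  proof -
    have "nrm p \<le> nrm (q s) + nrm (q s - p)" "nrm (q s - p) = nrm (p - q s)"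
      using nrm_triangle[of "q s" "q s - p"] assms nrm_scale[of "p - q s" "-1"]
      by (auto simp: scale_minus_left)
    moreover have "nrm (q s) \<le> nrm (q s - p) + nrm p"
      using nrm_triangle[of "q s - p" "- p"] assms nrm_scale[of p "-1"]
      by (auto simp: scale_minus_left subspace_neg[OF subspace])
    ultimately show ?thesis by simp
  qed
  then have "((\<lambda>s. nrm (q s) - nrm p) \<longlongrightarrow> 0) F"
    by (intro Lim_null_comparison[OF _ assms(3)]) auto
  then show ?thesis by (simp add: LIM_zero_iff)
qed

lemma complete_sq:
  assumes X: "\<And>n. X n \<in> V"
    and cauchy: "\<And>e. e > 0 \<Longrightarrow> \<exists>N. \<forall>m\<ge>N. \<forall>n\<ge>N. (nrm (X m - X n))\<^sup>2 < e"
  shows "\<exists>p\<in>V. (\<lambda>n. nrm (X n - p)) \<longlonglongrightarrow> 0"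
proof -
  have "\<exists>N. \<forall>m\<ge>N. \<forall>n\<ge>N. nrm (X m - X n) < e" if "e > 0" for e
    using cauchy[of "e\<^sup>2"] that by (meson power_less_imp_less_base less_imp_le zero_less_power)
  then show ?thesis
    using complete[of X] X by (simp add: nrm_def)
qed

text \<open>
  The relation \<open>G\<close> is the graph of a bounded linear functional on a subspace that need not be closed;
  the representing vector is the rescaled element of least norm in the closure of \<open>{u. (u, 1) \<in> G}\<close>.
\<close>

theorem riesz:
  assumes GV: "\<And>u l. (u, l) \<in> G \<Longrightarrow> u \<in> V"
    and add: "\<And>u l v m. (u, l) \<in> G \<Longrightarrow> (v, m) \<in> G \<Longrightarrow> (u + v, l + m) \<in> G"
    and scl: "\<And>c u l. (u, l) \<in> G \<Longrightarrow> (c \<odot> u, c * l) \<in> G"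
    and bound: "\<And>u l. (u, l) \<in> G \<Longrightarrow> cmod l \<le> C * nrm u"
    and C: "0 \<le> C"
  shows "\<exists>v\<in>V. nrm v \<le> C \<and> (\<forall>(u, l)\<in>G. ip u v = l)"
proof (cases "\<forall>(u, l)\<in>G. l = 0")
  case True
  then show ?thesis
    using GV C by (intro bexI[of _ 0]) (auto simp: ip_simps)
next
  case False
  define U where "U = {u. (u, 1) \<in> G}"
  from False obtain u0 l0 where "(u0, l0) \<in> G" "l0 \<noteq> 0" by blast
  then have "((1 / l0) \<odot> u0, 1) \<in> G" using scl[of u0 l0 "1 / l0"] by simp
  then have Une: "U \<noteq> {}" by (auto simp: U_def)
  have UV: "u \<in> V" if "u \<in> U" for u using that GV by (auto simp: U_def)
  have Gdiff: "(u - v, l - m) \<in> G" if "(u, l) \<in> G" "(v, m) \<in> G" for u l v m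
    using add[OF that(1) scl[OF that(2), of "-1"]] by simp
  define d where "d = Inf ((\<lambda>u. (nrm u)\<^sup>2) ` U)"
  have bdd: "bdd_below ((\<lambda>u. (nrm u)\<^sup>2) ` U)" by (rule bdd_belowI2[of _ 0]) simp
  have d_le: "d \<le> (nrm u)\<^sup>2" if "u \<in> U" for u
    unfolding d_def using bdd that by (rule cINF_lower)
  have "\<exists>u\<in>U. (nrm u)\<^sup>2 < d + inverse (real (Suc n))" for n
    using Une bdd cINF_less_iff[of U "\<lambda>u. (nrm u)\<^sup>2" "d + inverse (real (Suc n))"]
    by (auto simp: d_def)
  then obtain X where X: "\<And>n. X n \<in> U" "\<And>n. (nrm (X n))\<^sup>2 < d + inverse (real (Suc n))"
    by metis
  have XV: "X n \<in> V" for n using X UV by simp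
  have lim_inv: "(\<lambda>n. inverse (real (Suc n))) \<longlonglongrightarrow> 0" by (rule LIMSEQ_inverse_real_of_nat)
  \<comment> \<open>Parallelogram law: the midpoint of two elements of \<open>U\<close> has value
    \<open>(1/2) * (1 + 1) = 1\<close>, so it lies in \<open>U\<close> and its squared norm is at
    least \<open>d\<close>.\<close>
  have close: "(nrm (u - v))\<^sup>2 \<le> 2 * (nrm u)\<^sup>2 + 2 * (nrm v)\<^sup>2 - 4 * d"
    if "u \<in> U" "v \<in> U" for u v
  proof -
    have "((1/2) \<odot> (u + v), (1/2) * (1 + 1)) \<in> G"
      using that by (intro scl add) (auto simp: U_def)
    then have "d \<le> (nrm ((1/2) \<odot> (u + v)))\<^sup>2" by (intro d_le) (simp add: U_def)
    also have "\<dots> = (nrm (u + v))\<^sup>2 / 4" using that UV by (simp add: nrm_scale power_divide)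
    finally show ?thesis using parallelogram[of u v] that UV by simp
  qed
  obtain p where p: "p \<in> V" "(\<lambda>n. nrm (X n - p)) \<longlonglongrightarrow> 0"
  proof -
    have "\<exists>N. \<forall>m\<ge>N. \<forall>n\<ge>N. (nrm (X m - X n))\<^sup>2 < e" if "e > 0" for e
    proof -
      obtain N where N: "\<And>n. n \<ge> N \<Longrightarrow> inverse (real (Suc n)) < e / 4"
        using order_tendstoD(2)[OF lim_inv, of "e / 4"] \<open>e > 0\<close>
        by (auto simp: eventually_sequentially)
      have less: "(nrm (X n))\<^sup>2 < d + e / 4" if "n \<ge> N" for n
        using X(2)[of n] N[OF that] by (meson add_strict_left_mono less_trans)
      have "(nrm (X m - X n))\<^sup>2 < e" if "m \<ge> N" "n \<ge> N" for m n
        using close[OF X(1) X(1), of m n] less[OF that(1)] less[OF that(2)] by linarith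
      then show ?thesis by blast
    qed
    then show ?thesis using complete_sq[of X] XV that by blast
  qed
  \<comment> \<open>First-order minimality: removing from \<open>X n\<close> its component along a
    vector \<open>e\<close> of value 0 stays in \<open>U\<close>, so the squared norm drops by at
    most the gap \<open>1 / (n + 1)\<close>.\<close>
  have orth: "ip e p = 0" if e: "(e, 0) \<in> G" for e
  proof -
    have eV: "e \<in> V" using GV e by blast
    have "(cmod (ip e (X n)))\<^sup>2 \<le> inverse (real (Suc n)) * (nrm e)\<^sup>2" for n
    proof (cases "e = 0")
      case False
      then have n: "nrm e \<noteq> 0" using eV by (simp add: nrm_eq_0_iff)
      have "X n - (ip (X n) e / ip e e) \<odot> e \<in> U"
        using Gdiff[OF _ scl[OF e], of "X n" 1] X(1)[of n] by (simp add: U_def)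
      from d_le[OF this] have "(cmod (ip (X n) e))\<^sup>2 / (nrm e)\<^sup>2 \<le> inverse (real (Suc n))"
        using X(2)[of n] nrm_sub_projection_sq[OF XV eV, of n] by linarith
      moreover have "cmod (ip (X n) e) = cmod (ip e (X n))"
        by (metis ip_commute XV eV complex_mod_cnj)
      ultimately show ?thesis using n by (simp add: divide_simps split: if_splits)
    qed (use XV in \<open>simp add: ip_simps\<close>)
    moreover have "(\<lambda>n. inverse (real (Suc n)) * (nrm e)\<^sup>2) \<longlonglongrightarrow> 0"
      using tendsto_mult_left_zero[OF lim_inv] .
    ultimately have "(\<lambda>n. (cmod (ip e (X n)))\<^sup>2) \<longlonglongrightarrow> 0"
      by (intro Lim_null_comparison[where f="\<lambda>n. (cmod (ip e (X n)))\<^sup>2"]) auto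
    moreover have "(\<lambda>n. (cmod (ip e (X n)))\<^sup>2) \<longlonglongrightarrow> (cmod (ip e p))\<^sup>2"
      by (intro tendsto_intros tendsto_ip_right XV p eV)
    ultimately show ?thesis using LIMSEQ_unique by fastforce
  qed
  \<comment> \<open>Two elements of \<open>U\<close> differ by a vector of value 0, which is
    orthogonal to \<open>p\<close>; letting \<open>n\<close> tend to infinity replaces
    \<open>X n\<close> by \<open>p\<close>.\<close>
  have const: "ip u p = ip p p" if u: "u \<in> U" for u
  proof -
    have "ip (X n) p = ip u p" for n
      using orth[OF Gdiff[of u 1 "X n" 1, simplified]] u X(1)[of n] p XV UV
      by (simp add: U_def ip_diff_left)
    then show ?thesis
      using tendsto_ip_left[OF XV p(1) p(1) p(2)] LIMSEQ_unique[OF tendsto_const] by simp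
  qed
  have "1 \<le> C * nrm (X n)" for n using bound[of "X n" 1] X(1)[of n] by (simp add: U_def)
  then have pge: "1 \<le> C * nrm p"
    using tendsto_mult_left[OF tendsto_nrm[OF XV p], of C] by (auto intro: LIMSEQ_le_const)
  then have pn: "nrm p > 0" using nrm_nonneg[OF p(1)] by (cases "nrm p = 0") auto
  \<comment> \<open>On \<open>U\<close> the functional is 1 while \<open>ip u p = ip p p\<close>,
    hence the scaling; \<open>1 \<le> C * nrm p\<close> then becomes
    \<open>nrm ?v \<le> C\<close>.\<close>
  let ?v = "of_real (1 / (nrm p)\<^sup>2) \<odot> p"
  have "nrm ?v = 1 / nrm p" using p pn by (simp add: nrm_scale power2_eq_square norm_divide norm_mult)
  then have "nrm ?v \<le> C" using pge pn by (simp only: pos_divide_le_eq)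
  moreover have "ip u ?v = l" if ul: "(u, l) \<in> G" for u l
  proof -
    obtain w where w: "w \<in> U" using Une by blast
    have "(u - l \<odot> w, 0) \<in> G" using Gdiff[OF ul scl, of w 1 l] w by (simp add: U_def)
    from orth[OF this] have "ip u p = l * ip p p"
      using const[OF w] p UV[OF w] GV[OF ul] by (simp add: ip_simps)
    then show ?thesis using p GV[OF ul] pn by (simp add: ip_simps ip_self)
  qed
  ultimately show ?thesis using p by (intro bexI[of _ ?v]) auto
qed

text \<open>The square of \<open>nrm (q s - q t)\<close> is a combination of inner products whose
  weights cancel at a common limit. The double limit covers the diagonal \<open>s = t\<close>, so
  \<open>q\<close> is a Cauchy net at 0.\<close>

lemma tendsto_at_complete:
  fixes q :: "complex \<Rightarrow> 'v"
  assumes q: "\<And>s. q s \<in> V"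
    and lim: "((\<lambda>x. ip (q (fst x)) (q (snd x))) \<longlongrightarrow> L) (at 0 \<times>\<^sub>F at 0)"
  shows "\<exists>p\<in>V. ((\<lambda>s. nrm (q s - p)) \<longlongrightarrow> 0) (at 0)"
proof -
  have close: "\<exists>\<delta>>0. \<forall>s t. s \<noteq> 0 \<longrightarrow> t \<noteq> 0 \<longrightarrow> cmod s < \<delta> \<longrightarrow> cmod t < \<delta> \<longrightarrow> (nrm (q s - q t))\<^sup>2 < e"
    if "e > 0" for e
  proof -
    have "\<forall>\<^sub>F x in at 0 \<times>\<^sub>F at 0. dist (ip (q (fst x)) (q (snd x))) L < e / 4"
      using tendstoD[OF lim, of "e / 4"] \<open>e > 0\<close> by simp
    then obtain P Q where P: "eventually P (at 0)" and Q: "eventually Q (at 0)"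
      and PQ: "\<And>s t. P s \<Longrightarrow> Q t \<Longrightarrow> dist (ip (q s) (q t)) L < e / 4"
      unfolding eventually_prod_filter by auto
    from eventually_conj[OF P Q] obtain \<delta> where "\<delta> > 0"
      and \<delta>: "\<And>s. s \<noteq> 0 \<Longrightarrow> cmod s < \<delta> \<Longrightarrow> P s \<and> Q s"
      unfolding eventually_at by (auto simp: dist_norm)
    have "(nrm (q s - q t))\<^sup>2 < e" if "s \<noteq> 0" "t \<noteq> 0" "cmod s < \<delta>" "cmod t < \<delta>" for s t
    proof -
      have *: "Re (ip (q a) (q b)) < Re L + e / 4 \<and> Re L - e / 4 < Re (ip (q a) (q b))" if "a \<in> {s, t}" "b \<in> {s, t}" for a b
      proof -
        have "dist (ip (q a) (q b)) L < e / 4"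
          using that \<open>s \<noteq> 0\<close> \<open>t \<noteq> 0\<close> \<open>cmod s < \<delta>\<close> \<open>cmod t < \<delta>\<close> by (intro PQ) (use \<delta> in blast)+
        then show ?thesis
          using abs_Re_le_cmod[of "ip (q a) (q b) - L"] by (simp add: dist_norm abs_le_iff)
      qed
      have "(nrm (q a))\<^sup>2 = Re (ip (q a) (q a))" for a using q by (simp add: ip_self)
      then show ?thesis
        using *[of s s] *[of t t] *[of s t] nrm_diff_sq[OF q q, of s t] by simp
    qed
    then show ?thesis using \<open>\<delta> > 0\<close> by blast
  qed
  \<comment> \<open>Completeness concerns sequences, so the limit is found along the nonzero points
    \<open>1 / (n + 1)\<close>; the Cauchy condition carries it to the whole net.\<close>
  define h :: "nat \<Rightarrow> complex" where "h n = of_real (inverse (real (Suc n)))" for n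
  have h0: "h n \<noteq> 0" for n by (simp add: h_def del: of_nat_Suc)
  have hlim: "h \<longlonglongrightarrow> 0" 
    unfolding h_def
    using tendsto_of_real[OF LIMSEQ_inverse_real_of_nat, where 'a=complex] unfolding of_real_0 .
  have hsmall: "\<exists>N. \<forall>n\<ge>N. cmod (h n) < \<delta>" if "\<delta> > 0" for \<delta>
    using hlim that by (auto simp: LIMSEQ_iff)
  obtain p where p: "p \<in> V" "(\<lambda>n. nrm (q (h n) - p)) \<longlonglongrightarrow> 0"
  proof -
    have "\<exists>N. \<forall>m\<ge>N. \<forall>n\<ge>N. (nrm (q (h m) - q (h n)))\<^sup>2 < e" if "e > 0" for e
      using close[OF that] hsmall h0 by meson
    then show ?thesis using complete_sq[of "\<lambda>n. q (h n)"] q that by blast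
  qed
  have "\<forall>\<^sub>F s in at 0. dist (nrm (q s - p)) 0 < e" if "e > 0" for e
  proof -
    obtain \<delta> where "\<delta> > 0" and \<delta>: "\<And>s t. s \<noteq> 0 \<Longrightarrow> t \<noteq> 0 \<Longrightarrow> cmod s < \<delta> \<Longrightarrow> cmod t < \<delta> \<Longrightarrow>
        (nrm (q s - q t))\<^sup>2 < (e/2)\<^sup>2"
      using close[of "(e/2)\<^sup>2"] \<open>e > 0\<close> by auto
    have "dist (nrm (q s - p)) 0 < e" if s: "s \<noteq> 0" "cmod s < \<delta>" for s
    proof -
      have "(\<lambda>n. nrm ((q s - q (h n)) - (q s - p))) \<longlonglongrightarrow> 0"
      proof -
        have "nrm ((q s - q (h n)) - (q s - p)) = nrm (q (h n) - p)" for n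
          using nrm_scale[of "q (h n) - p" "-1"] p q by (simp add: scale_minus_left)
        then show ?thesis using p(2) by simp
      qed
      then have "(\<lambda>n. nrm (q s - q (h n))) \<longlonglongrightarrow> nrm (q s - p)"
        using p q by (intro tendsto_nrm) auto
      moreover obtain N where "\<forall>n\<ge>N. cmod (h n) < \<delta>" using hsmall \<open>\<delta> > 0\<close> by blast
      then have "\<forall>n\<ge>N. nrm (q s - q (h n)) \<le> e / 2"
        using \<delta>[OF s(1) h0 s(2)] \<open>e > 0\<close> by (meson power_less_imp_less_base less_imp_le half_gt_zero)
      ultimately have "nrm (q s - p) \<le> e / 2" by (meson LIMSEQ_le_const2)
      then show ?thesis using \<open>e > 0\<close> p q by (simp add: dist_real_def)
    qed
    then show ?thesis using \<open>\<delta> > 0\<close> unfolding eventually_at by (auto simp: dist_norm)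
  qed
  then show ?thesis using p(1) unfolding tendsto_iff by blast
qed

text \<open>
  Splitting off the component of the vectors along one of them turns the second factor into a
  rank-one Gram matrix plus a Gram matrix on a smaller index set.
\<close>

lemma schur_product:
  assumes "finite S"
    and a: "\<And>c. 0 \<le> Re (\<Sum>i\<in>S. \<Sum>j\<in>S. c i * cnj (c j) * a i j)"
    and f: "\<And>i. f i \<in> V"
  shows "0 \<le> Re (\<Sum>i\<in>S. \<Sum>j\<in>S. c i * cnj (c j) * (a i j * ip (f i) (f j)))"
  using assms
proof (induction S arbitrary: f rule: finite_induct)
  case (insert k S)
  define g where "g i = f i - (ip (f i) (f k) / ip (f k) (f k)) \<odot> f k" for i
  have gV: "g i \<in> V" for i using insert.prems by (simp add: g_def)
  \<comment> \<open>The index \<open>k\<close> drops out of the Gram matrix of \<open>g\<close>,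
    which lets the induction descend to \<open>S\<close>. A vanishing denominator means
    \<open>f k = 0\<close> by definiteness.\<close>
  have gk: "g k = 0"
    using insert.prems ip_definite[of "f k"] by (cases "ip (f k) (f k) = 0") (auto simp: g_def)
  have split: "ip (f i) (f j) = ip (f i) (f k) * cnj (ip (f j) (f k)) / ip (f k) (f k) + ip (g i) (g j)"
    for i j
  proof (cases "f k = 0")
    case False
    then have "ip (f k) (f k) \<noteq> 0" using insert.prems ip_definite by blast
    moreover have "cnj (ip (f k) (f k)) = ip (f k) (f k)" "cnj (ip (f j) (f k)) = ip (f k) (f j)"
      using insert.prems ip_commute by metis+
    ultimately show ?thesis using insert.prems by (simp add: g_def ip_simps)
  qed (use insert.prems in \<open>simp add: g_def ip_simps\<close>)
  \<comment> \<open>Positivity over \<open>insert k S\<close> restricts to \<open>S\<close> by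
    setting the coefficient at \<open>k\<close> to 0.\<close>
  have aS: "0 \<le> Re (\<Sum>i\<in>S. \<Sum>j\<in>S. c i * cnj (c j) * a i j)" for c
  proof -
    have *: "(\<Sum>i\<in>insert k S. \<Sum>j\<in>insert k S. (c(k := 0)) i * cnj ((c(k := 0)) j) * a i j)
        = (\<Sum>i\<in>S. \<Sum>j\<in>S. (c(k := 0)) i * cnj ((c(k := 0)) j) * a i j)"
      using insert.hyps by simp
    also have "\<dots> = (\<Sum>i\<in>S. \<Sum>j\<in>S. c i * cnj (c j) * a i j)"
      using insert.hyps by (intro sum.cong refl) auto
    finally show ?thesis using insert.prems(1)[of "c(k := 0)"] by simp
  qed
  \<comment> \<open>The rank-one part is absorbed into the coefficients, leaving the form of
    \<open>a\<close> at \<open>?c\<close> divided by the nonnegative real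
    \<open>ip (f k) (f k)\<close>.\<close>
  let ?c = "\<lambda>i. c i * ip (f i) (f k)"
  have "(\<Sum>i\<in>insert k S. \<Sum>j\<in>insert k S. c i * cnj (c j) * (a i j * ip (f i) (f j)))
      = (\<Sum>i\<in>insert k S. \<Sum>j\<in>insert k S. ?c i * cnj (?c j) * a i j) / ip (f k) (f k)
       + (\<Sum>i\<in>insert k S. \<Sum>j\<in>insert k S. c i * cnj (c j) * (a i j * ip (g i) (g j)))"
    unfolding sum_divide_distrib sum.distrib[symmetric]
    by (intro sum.cong refl, subst split) (simp add: algebra_simps)
  also have "(\<Sum>i\<in>insert k S. \<Sum>j\<in>insert k S. c i * cnj (c j) * (a i j * ip (g i) (g j)))
      = (\<Sum>i\<in>S. \<Sum>j\<in>S. c i * cnj (c j) * (a i j * ip (g i) (g j)))"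
    using insert.hyps gV by (simp add: gk ip_simps)
  finally show ?case
    using insert.IH[OF aS gV] insert.prems(1)[of ?c] insert.prems(2)
    by (simp add: ip_self[of "f k"] flip: of_real_power)
qed simp

end

section \<open>Adjoints and square roots\<close>

interpretation E: hilbert_subspace
    "scaleC :: complex \<Rightarrow> 'a::complex_hilbert_space \<Rightarrow> 'a" UNIV cinner
  rewrites "hilbert_subspace.nrm cinner = (norm :: 'a \<Rightarrow> real)"
proof -
  have vs: "vector_space (scaleC :: complex \<Rightarrow> 'a \<Rightarrow> 'a)"
    by unfold_locales
      (auto simp: scaleC_add_right scaleC_add_left scaleC_scaleC scaleC_one)
  interpret vector_space "scaleC :: complex \<Rightarrow> 'a \<Rightarrow> 'a" by (rule vs)
  have norm: "sqrt (Re (cinner x x)) = norm x" for x :: 'a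
    by (simp add: Re_cinner norm_eq_sqrt_inner)
  show "hilbert_subspace (scaleC :: complex \<Rightarrow> 'a \<Rightarrow> 'a) UNIV cinner"
  proof unfold_locales
    fix u v w :: 'a and c :: complex
    show "cinner u v = cnj (cinner v u)" by (rule cinner_commute)
    show "0 \<le> Re (cinner u u)" by (simp add: Re_cinner)
    show "u = 0" if "cinner u u = 0" using that norm[of u] by simp
  next
    fix X :: "nat \<Rightarrow> 'a"
    assume "\<And>e. e > 0 \<Longrightarrow> \<exists>N. \<forall>m\<ge>N. \<forall>n\<ge>N. sqrt (Re (cinner (X m - X n) (X m - X n))) < e"
    then have "Cauchy X" by (auto simp: norm Cauchy_def dist_norm)
    then obtain p where "X \<longlonglongrightarrow> p" using Cauchy_convergent_iff convergent_def by blast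
    then have "(\<lambda>n. norm (X n - p)) \<longlonglongrightarrow> 0" using LIM_zero tendsto_norm_zero by blast
    then show "\<exists>p\<in>UNIV. (\<lambda>n. sqrt (Re (cinner (X n - p) (X n - p)))) \<longlonglongrightarrow> 0"
      by (auto simp: norm)
  qed (auto simp: cinner_add_left cinner_scaleC_left subspace_UNIV)
  then interpret hilbert_subspace "scaleC :: complex \<Rightarrow> 'a \<Rightarrow> 'a" UNIV cinner .
  show "hilbert_subspace.nrm cinner = (norm :: 'a \<Rightarrow> real)"
    by (simp add: fun_eq_iff nrm_def norm)
qed

section \<open>Inner product of E, adjoints and positive operators\<close>

lemma cinner_ext:
  fixes x y :: "'a::complex_hilbert_space"
  assumes "\<And>z. cinner z x = cinner z y"
  shows "x = y"
proof -
  have "cinner (x - y) (x - y) = 0" using assms by (simp add: E.ip_diff_right)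
  then show ?thesis using E.ip_definite by force
qed

lemma norm_scaleC: "norm (c *\<^sub>C x) = cmod c * norm (x::'a::complex_hilbert_space)"
  by (rule E.nrm_scale) simp

lemma cmod_cinner_le: "cmod (cinner x y) \<le> norm x * norm (y::'a::complex_hilbert_space)"
  by (rule E.cauchy_schwarz) simp_all

lemma cinner_scaleR_left: "cinner (r *\<^sub>R x) y = of_real r * cinner x (y::'a::complex_hilbert_space)"
  by (simp add: scaleR_scaleC cinner_scaleC_left)

lemma cinner_scaleR_right: "cinner x (r *\<^sub>R y) = of_real r * cinner x (y::'a::complex_hilbert_space)"
  by (simp add: scaleR_scaleC E.ip_scale_right)

lemma scaleC_scaleR_commute: "c *\<^sub>C (r *\<^sub>R x) = r *\<^sub>R (c *\<^sub>C (x::'a::complex_hilbert_space))"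
  by (simp add: scaleR_scaleC scaleC_scaleC mult.commute)

lemma bounded_bilinear_cinner:
  "bounded_bilinear (cinner :: 'a::complex_hilbert_space \<Rightarrow> 'a \<Rightarrow> complex)"
  by unfold_locales
    (auto simp: E.ip_simps cinner_scaleR_left cinner_scaleR_right scaleR_conv_of_real
      intro!: exI[of _ 1] cmod_cinner_le)

lemma bounded_linear_scaleC: "bounded_linear (scaleC c :: 'a::complex_hilbert_space \<Rightarrow> 'a)"
  by (rule bounded_linear_intro[of _ "cmod c"])
    (auto simp: scaleC_add_right scaleC_scaleR_commute norm_scaleC mult.commute)

lemmas tendsto_cinner = bounded_bilinear.tendsto[OF bounded_bilinear_cinner]
lemmas tendsto_scaleC = bounded_linear.tendsto[OF bounded_linear_scaleC]

lemma bounded_clinearD: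
  fixes A :: "'a::complex_hilbert_space \<Rightarrow> 'a"
  assumes "bounded_clinear A"
  shows "bounded_linear A" "A (x + y) = A x + A y" "A (x - y) = A x - A y" "A 0 = 0"
    "A (- x) = - A x" "A (c *\<^sub>C x) = c *\<^sub>C A x" "A (r *\<^sub>R x) = r *\<^sub>R A x"
  using assms bounded_linear.linear[of A]
  by (auto simp: bounded_clinear_def linear_add linear_diff linear_0 linear_neg linear_cmul)

lemma bounded_clinearI:
  fixes A :: "'a::complex_hilbert_space \<Rightarrow> 'a"
  assumes "\<And>x y. A (x + y) = A x + A y" "\<And>c x. A (c *\<^sub>C x) = c *\<^sub>C A x"
    "\<And>x. norm (A x) \<le> K * norm x"
  shows "bounded_clinear A"
  unfolding bounded_clinear_def
  using assms by (auto intro!: bounded_linear_intro[of A K] simp: scaleR_scaleC mult.commute)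

text \<open>Riesz represents \<open>x \<mapsto> cinner (A x) y\<close>, which has the bound
  \<open>onorm A * norm y\<close>; nondegeneracy of the inner product gives the uniqueness required
  by \<open>THE\<close> in \<open>cadjoint\<close>.\<close>

lemma cinner_cadjoint:
  fixes A :: "'a::complex_hilbert_space \<Rightarrow> 'a"
  assumes A: "bounded_clinear A"
  shows "cinner (A x) y = cinner x (cadjoint A y)"
proof -
  have "\<exists>v. \<forall>x. cinner (A x) y = cinner x v" for y
  proof -
    let ?G = "{(x, cinner (A x) y) | x. True}"
    have "\<exists>v\<in>UNIV. norm v \<le> onorm A * norm y \<and> (\<forall>(u, l)\<in>?G. cinner u v = l)"
    proof (rule E.riesz)
      fix u l assume "(u, l) \<in> ?G"
      then have "cmod l \<le> norm (A u) * norm y" using cmod_cinner_le by auto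
      also have "\<dots> \<le> (onorm A * norm u) * norm y"
        using onorm[OF bounded_clinearD(1)[OF A], of u] by (simp add: mult_right_mono)
      finally show "cmod l \<le> onorm A * norm y * norm u" by (simp add: mult_ac)
    qed (auto simp: bounded_clinearD[OF A] cinner_add_left cinner_scaleC_left
        onorm_pos_le[OF bounded_clinearD(1)[OF A]])
    then show ?thesis by fastforce
  qed
  then obtain B where B: "\<And>x y. cinner (A x) y = cinner x (B y)" by metis
  have "cadjoint A = B"
    unfolding cadjoint_def
  proof (rule the_equality)
    fix B' assume B': "\<forall>x y. cinner (A x) y = cinner x (B' y)"
    show "B' = B" by (rule ext, rule cinner_ext) (metis B B')
  qed (use B in simp)
  then show ?thesis using B by simp
qed

text \<open>Polarization: reality of the form at \<open>x + y\<close> matches the imaginary parts,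
  reality at \<open>x + \<i> *\<^sub>C y\<close> the real parts.\<close>

lemma symmetric_of_real_form:
  fixes T :: "'a::complex_hilbert_space \<Rightarrow> 'a"
  assumes T: "bounded_clinear T" and real: "\<And>x. cinner (T x) x \<in> \<real>"
  shows "cinner (T x) y = cinner x (T y)"
proof -
  have "Im (cinner (T (x + y)) (x + y)) = 0" "Im (cinner (T (x + \<i> *\<^sub>C y)) (x + \<i> *\<^sub>C y)) = 0"
    "Im (cinner (T x) x) = 0" "Im (cinner (T y) y) = 0"
    using real complex_is_Real_iff by blast+
  then have "Im (cinner (T x) y) = - Im (cinner (T y) x)" "Re (cinner (T x) y) = Re (cinner (T y) x)"
    by (simp_all add: bounded_clinearD[OF T] E.ip_simps)
  then have "cinner (T x) y = cnj (cinner (T y) x)" by (simp add: complex_eq_iff)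
  then show ?thesis by (simp flip: cinner_commute)
qed

lemma
  fixes T :: "'a::complex_hilbert_space \<Rightarrow> 'a"
  assumes T: "positive_operator T"
  shows positive_operator_clinear: "bounded_clinear T"
    and positive_operator_symmetric: "cinner (T x) y = cinner x (T y)"
    and positive_operator_eq_0: "cinner (T x) x = 0 \<Longrightarrow> T x = 0"
proof -
  show lin: "bounded_clinear T" using T by (simp add: positive_operator_def)
  have form: "cinner (T x) x \<in> \<real>\<^sub>\<ge>\<^sub>0" for x using T by (simp add: positive_operator_def)
  then show sym: "cinner (T x) y = cinner x (T y)" for x y
    by (intro symmetric_of_real_form lin) (auto intro: nonneg_Reals_subset_Reals[THEN subsetD])
  have pos: "0 \<le> Re (cinner (T x) x)" for x using form[of x] by (simp add: complex_nonneg_Reals_iff)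
  show "T x = 0" if "cinner (T x) x = 0"
  proof -
    define a where "a = (norm (T x))\<^sup>2"
    define b where "b = Re (cinner (T (T x)) (T x))"
    have b: "b \<ge> 0" using pos by (simp add: b_def)
    \<comment> \<open>The form at \<open>x + t *\<^sub>R T x\<close> is
      \<open>2 * t * a + t^2 * b\<close>. This \<open>t\<close> makes it
      \<open>- a^2 * (b + 2) / (b + 1)^2\<close>, forcing \<open>a = 0\<close>; \<open>b + 1\<close>
      keeps the denominator positive when \<open>b = 0\<close>.\<close>
    define t where "t = - a / (b + 1)"
    have xTx: "cinner x (T x) = 0" using that sym[of x x] by simp
    have ineq: "0 \<le> 2 * t * a + t\<^sup>2 * b"
      using pos[of "x + t *\<^sub>R T x"] that xTx E.ip_self[of "T x"] sym[of "T x" x]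
      by (simp add: bounded_clinearD[OF lin] E.ip_simps cinner_scaleR_left cinner_scaleR_right a_def b_def
          power2_eq_square algebra_simps)
    have "t * (b + 1) = - a" using b by (simp add: t_def)
    then have "(b + 1)\<^sup>2 * (2 * t * a + t\<^sup>2 * b) = - (a\<^sup>2 * (b + 2))" by algebra
    then have "a\<^sup>2 * (b + 2) \<le> 0" using ineq by (metis neg_0_le_iff_le mult_nonneg_nonneg zero_le_power2)
    then have "a = 0" using b by (simp add: mult_le_0_iff)
    then show ?thesis by (simp add: a_def)
  qed
qed

section \<open>Square root of I - X for a self-adjoint contraction X\<close>

text \<open>\<open>nonneg_poly X Y r\<close>: \<open>Y\<close> is a polynomial in \<open>X\<close> with nonnegative coefficients of sum \<open>r\<close>.\<close>

inductive nonneg_poly :: "('a::complex_hilbert_space \<Rightarrow> 'a) \<Rightarrow> ('a \<Rightarrow> 'a) \<Rightarrow> real \<Rightarrow> bool"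
  for X where
  zero: "nonneg_poly X (\<lambda>x. 0) 0"
| var: "nonneg_poly X X 1"
| add: "nonneg_poly X Y r \<Longrightarrow> nonneg_poly X Z s \<Longrightarrow> nonneg_poly X (\<lambda>x. Y x + Z x) (r + s)"
| comp: "nonneg_poly X Y r \<Longrightarrow> nonneg_poly X Z s \<Longrightarrow> nonneg_poly X (\<lambda>x. Y (Z x)) (r * s)"
| scale: "0 \<le> a \<Longrightarrow> nonneg_poly X Y r \<Longrightarrow> nonneg_poly X (\<lambda>x. a *\<^sub>R Y x) (a * r)"

locale selfadjoint_contraction =
  fixes X :: "'a::complex_hilbert_space \<Rightarrow> 'a"
  assumes X_add: "X (x + y) = X x + X y"
    and X_scaleC: "X (c *\<^sub>C x) = c *\<^sub>C X x"
    and X_symmetric: "cinner (X x) y = cinner x (X y)"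
    and X_contraction: "norm (X x) \<le> norm x"
begin

lemma poly_nonneg: "nonneg_poly X Y r \<Longrightarrow> 0 \<le> r"
  by (induction rule: nonneg_poly.induct) auto

lemma poly_bound: "nonneg_poly X Y r \<Longrightarrow> norm (Y x) \<le> r * norm x"
proof (induction arbitrary: x rule: nonneg_poly.induct)
  case (add Y r Z s)
  then show ?case using norm_triangle_mono[OF add.IH(1)[of x] add.IH(2)[of x]]
    by (simp add: algebra_simps)
next
  case (comp Y r Z s)
  have "norm (Y (Z x)) \<le> r * norm (Z x)" by (rule comp.IH)
  also have "\<dots> \<le> r * (s * norm x)"
    using comp poly_nonneg by (intro mult_left_mono) auto
  finally show ?case by (simp add: mult.assoc)
qed (auto simp: X_contraction mult_left_mono mult.assoc)

lemma poly_scaleC: "nonneg_poly X Y r \<Longrightarrow> Y (c *\<^sub>C x) = c *\<^sub>C Y x"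
  by (induction arbitrary: x rule: nonneg_poly.induct)
    (auto simp: X_scaleC scaleC_add_right scaleC_scaleR_commute)

lemma poly_add: "nonneg_poly X Y r \<Longrightarrow> Y (x + y) = Y x + Y y"
  by (induction arbitrary: x y rule: nonneg_poly.induct)
    (auto simp: X_add scaleR_add_right)

text \<open>\<open>W\<close> is left abstract for two uses: another polynomial in \<open>X\<close>,
  and, in the uniqueness proof, an arbitrary positive root of \<open>I - X\<close>.\<close>

lemma poly_commute:
  assumes "nonneg_poly X Y r" and "\<And>x. W (X x) = X (W x)"
    and "\<And>x y. W (x + y) = W x + W y" "\<And>c x. W (c *\<^sub>C x) = c *\<^sub>C W x"
  shows "W (Y x) = Y (W x)"
  using assms
proof (induction arbitrary: x rule: nonneg_poly.induct)
  case zero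
  then show ?case by (metis E.scale_zero_left)
qed (auto simp: scaleR_scaleC)

lemma poly_commute_poly:
  assumes "nonneg_poly X Y r" "nonneg_poly X Z s"
  shows "Y (Z x) = Z (Y x)"
proof -
  have "X (Z x) = Z (X x)" for x
    using assms(2) by (rule poly_commute) (auto simp: X_add X_scaleC)
  then have "Z (X x) = X (Z x)" for x by simp
  then have "Z (Y x) = Y (Z x)"
    by (intro poly_commute[OF assms(1)] poly_add[OF assms(2)] poly_scaleC[OF assms(2)])
  then show ?thesis by simp
qed

text \<open>A composition of symmetric operators is symmetric here because polynomials in
  \<open>X\<close> commute.\<close>

lemma poly_symmetric: "nonneg_poly X Y r \<Longrightarrow> cinner (Y x) y = cinner x (Y y)"
proof (induction arbitrary: x y rule: nonneg_poly.induct)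
  case (comp Y r Z s)
  then show ?case using poly_commute_poly by metis
qed (auto simp: E.ip_simps X_symmetric cinner_scaleR_left cinner_scaleR_right)

text \<open>
  The iteration \<open>Y' = (X + Y\<^sup>2) / 2\<close> for \<open>1 - sqrt (1 - X)\<close>, together with its scalar shadow at
  \<open>X = 1\<close>: as \<open>Y\<^sub>m - Y\<^sub>n\<close> has nonnegative coefficients, the scalar difference bounds its norm.
\<close>

primrec iter :: "nat \<Rightarrow> 'a \<Rightarrow> 'a" where
  "iter 0 = (\<lambda>x. 0)"
| "iter (Suc n) = (\<lambda>x. (1/2) *\<^sub>R (X x + iter n (iter n x)))"

primrec iter_val :: "nat \<Rightarrow> real" where
  "iter_val 0 = 0"
| "iter_val (Suc n) = (1/2) * (1 + iter_val n * iter_val n)"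

lemma poly_iter: "nonneg_poly X (iter n) (iter_val n)"
proof (induction n)
  case (Suc n)
  show ?case
    unfolding iter.simps iter_val.simps
    by (intro nonneg_poly.scale nonneg_poly.add nonneg_poly.var nonneg_poly.comp Suc) simp
qed (simp add: nonneg_poly.zero)

lemma iter_val_nonneg: "0 \<le> iter_val n"
  using poly_nonneg[OF poly_iter] .

lemma iter_val_le_1: "iter_val n \<le> 1"
proof (induction n)
  case (Suc n)
  then show ?case using mult_mono[of "iter_val n" 1 "iter_val n" 1] iter_val_nonneg[of n] by simp
qed simp

text \<open>For consecutive iterates \<open>Y\<close>, \<open>Z\<close> the next difference is
  \<open>(Z^2 - Y^2) / 2 = (Z - Y) (Z + Y) / 2\<close>, as they commute; so nonnegativity passes on
  from \<open>Z - Y\<close>.\<close>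

lemma poly_iter_step: "nonneg_poly X (\<lambda>x. iter (Suc n) x - iter n x) (iter_val (Suc n) - iter_val n)"
proof (induction n)
  case 0
  then show ?case using nonneg_poly.scale[OF _ nonneg_poly.var, of "1/2" X] by simp
next
  case (Suc n)
  define Y Z y z where defs: "Y = iter n" "Z = iter (Suc n)" "y = iter_val n" "z = iter_val (Suc n)"
  have Y: "nonneg_poly X Y y" and Z: "nonneg_poly X Z z" unfolding defs by (rule poly_iter)+
  have Zx: "Z x = (1/2) *\<^sub>R (X x + Y (Y x))" for x by (simp add: defs)
  have z: "z = (1/2) * (1 + y * y)" by (simp add: defs)
  have "nonneg_poly X (\<lambda>x. (1/2) *\<^sub>R (Z (Z x + Y x) - Y (Z x + Y x))) ((1/2) * ((z - y) * (z + y)))"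
    by (rule nonneg_poly.scale[OF _ nonneg_poly.comp[OF Suc[folded defs] nonneg_poly.add[OF Z Y]]]) simp
  moreover have "(1/2) *\<^sub>R (Z (Z x + Y x) - Y (Z x + Y x)) = (1/2) *\<^sub>R (X x + Z (Z x)) - Z x" for x
  proof -
    have "Z (Z x + Y x) - Y (Z x + Y x) = Z (Z x) - Y (Y x)"
      by (simp add: poly_add[OF Y] poly_add[OF Z] poly_commute_poly[OF Y Z])
    then show ?thesis
      using arg_cong[OF Zx[of x], of "\<lambda>w. (1/2) *\<^sub>R (X x + Z (Z x)) - w"]
      by (simp flip: scaleR_diff_right)
  qed
  moreover have "(1/2) * ((z - y) * (z + y)) = (1/2) * (1 + z * z) - z"
    by (subst (4) z) (simp add: algebra_simps)
  ultimately show ?case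
    unfolding iter.simps(2)[of "Suc n"] iter_val.simps(2)[of "Suc n"] defs[symmetric] by (simp only:)
qed

lemma poly_iter_diff: "n \<le> m \<Longrightarrow> nonneg_poly X (\<lambda>x. iter m x - iter n x) (iter_val m - iter_val n)"
proof (induction m rule: dec_induct)
  case (step m)
  then show ?case using nonneg_poly.add[OF poly_iter_step[of m] step.IH] by (simp del: iter.simps iter_val.simps)
qed (simp add: nonneg_poly.zero)

text \<open>The scalar shadow increases and stays below 1, hence is Cauchy, and
  \<open>poly_bound\<close> transfers its differences to the iterates.\<close>

lemma convergent_iter: "convergent (\<lambda>n. iter n x)"
proof -
  have "incseq iter_val"
    by (rule incseq_SucI) (use poly_nonneg[OF poly_iter_step] in simp)
  then have "convergent iter_val"
    using incseq_convergent[of iter_val 1] iter_val_le_1 convergentI by metis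
  then have cauchy: "Cauchy iter_val" by (rule convergent_Cauchy)
  have bound: "norm (iter m x - iter n x) \<le> \<bar>iter_val m - iter_val n\<bar> * norm x" if "n \<le> m" for m n
    using poly_bound[OF poly_iter_diff[OF that], of x]
      poly_nonneg[OF poly_iter_diff[OF that]] by simp
  have bound': "norm (iter m x - iter n x) \<le> \<bar>iter_val m - iter_val n\<bar> * norm x" for m n
    using bound[of m n] bound[of n m] by (metis nle_le norm_minus_commute abs_minus_commute)
  have "Cauchy (\<lambda>n. iter n x)"
    unfolding Cauchy_iff
  proof (intro allI impI)
    fix e :: real assume "0 < e"
    then have "0 < e / (norm x + 1)" by (simp add: add_nonneg_pos)
    then obtain M where M: "\<And>m n. m \<ge> M \<Longrightarrow> n \<ge> M \<Longrightarrow> \<bar>iter_val m - iter_val n\<bar> < e / (norm x + 1)"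
      using cauchy unfolding Cauchy_iff by (metis real_norm_def)
    have "norm (iter m x - iter n x) < e" if "m \<ge> M" "n \<ge> M" for m n
    proof -
      have "norm (iter m x - iter n x) \<le> \<bar>iter_val m - iter_val n\<bar> * (norm x + 1)"
        using bound'[of m n] by (simp add: algebra_simps)
      also have "\<dots> < e" using M[OF that] by (simp add: pos_less_divide_eq add_nonneg_pos)
      finally show ?thesis .
    qed
    then show "\<exists>M. \<forall>m\<ge>M. \<forall>n\<ge>M. norm (iter m x - iter n x) < e" by blast
  qed
  then show ?thesis by (rule Cauchy_convergent)
qed

definition limit_op :: "'a \<Rightarrow> 'a" where "limit_op x = lim (\<lambda>n. iter n x)"

lemma iter_tendsto: "(\<lambda>n. iter n x) \<longlonglongrightarrow> limit_op x"
  using convergent_iter unfolding limit_op_def convergent_LIMSEQ_iff .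

lemma norm_iter_le: "norm (iter n x) \<le> norm x"
  using poly_bound[OF poly_iter, of n x] mult_right_mono[OF iter_val_le_1, of "norm x" n] by simp

text \<open>In \<open>iter n (iter n x)\<close> both occurrences move with \<open>n\<close>;
  contractivity of every iterate allows replacing the inner one by \<open>limit_op x\<close> before
  taking the limit.\<close>

lemma limit_op_eq: "limit_op x = (1/2) *\<^sub>R (X x + limit_op (limit_op x))"
proof -
  have diff: "iter n (iter n x) - iter n (limit_op x) = iter n (iter n x - limit_op x)" for n
    using poly_add[OF poly_iter, of n "iter n x - limit_op x" "limit_op x"] by simp
  have "(\<lambda>n. norm (iter n x - limit_op x)) \<longlonglongrightarrow> 0"
    using LIM_zero[OF iter_tendsto] tendsto_norm_zero by blast
  then have "(\<lambda>n. iter n (iter n x) - iter n (limit_op x)) \<longlonglongrightarrow> 0"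
    by (rule Lim_null_comparison[rotated]) (simp add: diff norm_iter_le)
  from tendsto_add[OF this iter_tendsto[of "limit_op x"]] have "(\<lambda>n. iter n (iter n x)) \<longlonglongrightarrow> limit_op (limit_op x)"
    by simp
  then have "(\<lambda>n. iter (Suc n) x) \<longlonglongrightarrow> (1/2) *\<^sub>R (X x + limit_op (limit_op x))"
    unfolding iter.simps by (intro tendsto_intros)
  moreover have "(\<lambda>n. iter (Suc n) x) \<longlonglongrightarrow> limit_op x"
    using iter_tendsto by (rule LIMSEQ_Suc)
  ultimately show ?thesis using LIMSEQ_unique by blast
qed

lemma limit_op_add: "limit_op (x + y) = limit_op x + limit_op y"
proof (rule LIMSEQ_unique)
  show "(\<lambda>n. iter n (x + y)) \<longlonglongrightarrow> limit_op x + limit_op y"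
    unfolding poly_add[OF poly_iter] by (intro tendsto_add iter_tendsto)
qed (rule iter_tendsto)

lemma limit_op_scaleC: "limit_op (c *\<^sub>C x) = c *\<^sub>C limit_op x"
proof (rule LIMSEQ_unique)
  show "(\<lambda>n. iter n (c *\<^sub>C x)) \<longlonglongrightarrow> c *\<^sub>C limit_op x"
    unfolding poly_scaleC[OF poly_iter] by (intro tendsto_scaleC iter_tendsto)
qed (rule iter_tendsto)

lemma limit_op_symmetric: "cinner (limit_op x) y = cinner x (limit_op y)"
proof (rule LIMSEQ_unique)
  show "(\<lambda>n. cinner (iter n x) y) \<longlonglongrightarrow> cinner x (limit_op y)"
    unfolding poly_symmetric[OF poly_iter] by (intro tendsto_cinner tendsto_const iter_tendsto)
qed (intro tendsto_cinner tendsto_const iter_tendsto)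

lemma norm_limit_op_le: "norm (limit_op x) \<le> norm x"
  using norm_iter_le by (intro LIMSEQ_le_const2[OF tendsto_norm[OF iter_tendsto]]) auto

definition sqrt_op :: "'a \<Rightarrow> 'a" where "sqrt_op x = x - limit_op x"

lemma bounded_clinear_sqrt_op: "bounded_clinear sqrt_op"
proof (rule bounded_clinearI[where K=2])
  fix x
  show "norm (sqrt_op x) \<le> 2 * norm x"
    using norm_triangle_ineq4[of x "limit_op x"] norm_limit_op_le[of x] by (simp add: sqrt_op_def)
qed (auto simp: sqrt_op_def limit_op_add limit_op_scaleC E.scale_right_diff_distrib)

text \<open>For \<open>Y = limit_op\<close>, \<open>(I - Y)^2 = I - 2 Y + Y^2\<close>, and the
  fixed-point equation says \<open>2 Y = X + Y^2\<close>.\<close>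

lemma sqrt_op_sqrt_op: "sqrt_op (sqrt_op x) = x - X x"
proof -
  have "sqrt_op (sqrt_op x) = sqrt_op x - sqrt_op (limit_op x)"
    using bounded_clinearD(3)[OF bounded_clinear_sqrt_op] by (simp add: sqrt_op_def)
  also have "\<dots> = x - 2 *\<^sub>R limit_op x + limit_op (limit_op x)"
    by (simp add: sqrt_op_def scaleR_2)
  also have "2 *\<^sub>R limit_op x = X x + limit_op (limit_op x)"
    by (subst limit_op_eq) simp
  finally show ?thesis by simp
qed

lemma positive_sqrt_op: "positive_operator sqrt_op"
  unfolding positive_operator_def
proof (intro conjI allI bounded_clinear_sqrt_op)
  fix x
  have "Im (cinner (limit_op x) x) = 0"
    using limit_op_symmetric[of x x] cinner_commute[of x "limit_op x"] by (simp add: complex_eq_iff)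
  moreover have "Re (cinner (limit_op x) x) \<le> norm x * norm x"
    using cmod_cinner_le[of "limit_op x" x] norm_limit_op_le[of x] complex_Re_le_cmod
      mult_right_mono[of "norm (limit_op x)" "norm x" "norm x"] by (smt (verit) norm_ge_zero)
  ultimately show "cinner (sqrt_op x) x \<in> \<real>\<^sub>\<ge>\<^sub>0"
    by (simp add: sqrt_op_def E.ip_simps E.ip_self complex_nonneg_Reals_iff power2_eq_square)
qed

text \<open>\<open>S\<close> commutes with \<open>S^2 = I - X\<close>, hence with the iterates and
  with \<open>sqrt_op\<close>. Thus \<open>(S + sqrt_op) (S - sqrt_op) = 0\<close>, and positivity
  makes both roots vanish at \<open>y = (S - sqrt_op) x\<close>; by symmetry
  \<open>cinner y y = 0\<close>.\<close>

lemma sqrt_op_unique: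
  assumes S: "positive_operator S" and SS: "\<And>x. S (S x) = x - X x"
  shows "S = sqrt_op"
proof
  fix x
  note lin = bounded_clinearD[OF positive_operator_clinear[OF S]]
  have "S (S (S x)) = S x - X (S x)" "S (S (S x)) = S x - S (X x)" for x
    using SS[of "S x"] arg_cong[OF SS, of S x] by (simp_all add: lin(3))
  then have "S (X x) = X (S x)" for x by (metis add_diff_cancel_left' diff_add_cancel)
  then have "S (iter n x) = iter n (S x)" for n x
    by (intro poly_commute[OF poly_iter]) (auto simp: lin)
  then have "(\<lambda>n. iter n (S x)) \<longlonglongrightarrow> S (limit_op x)" for x
    using bounded_linear.tendsto[OF lin(1) iter_tendsto, of x] by simp
  then have "S (limit_op x) = limit_op (S x)" for x using iter_tendsto LIMSEQ_unique by blast
  then have comm: "S (sqrt_op x) = sqrt_op (S x)" for x by (simp add: sqrt_op_def lin)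
  note lin' = bounded_clinearD[OF bounded_clinear_sqrt_op]
  define y where "y = S x - sqrt_op x"
  have "S y + sqrt_op y = 0"
    by (simp add: y_def lin lin' comm SS sqrt_op_sqrt_op)
  then have "cinner (S y) y + cinner (sqrt_op y) y = 0" by (metis E.ip_zero_left cinner_add_left UNIV_I)
  moreover have "cinner (S y) y \<in> \<real>\<^sub>\<ge>\<^sub>0" "cinner (sqrt_op y) y \<in> \<real>\<^sub>\<ge>\<^sub>0"
    using S positive_sqrt_op by (auto simp: positive_operator_def)
  ultimately have "cinner (S y) y = 0" "cinner (sqrt_op y) y = 0"
    by (auto simp: complex_nonneg_Reals_iff complex_eq_iff)
  then have "S y = 0" "sqrt_op y = 0"
    using positive_operator_eq_0 S positive_sqrt_op by blast+
  then have "cinner (S x - sqrt_op x) y = 0"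
    using positive_operator_symmetric[OF S, of x y] positive_operator_symmetric[OF positive_sqrt_op, of x y]
    by (simp add: E.ip_simps)
  then have "y = 0" unfolding y_def[symmetric] using E.ip_definite by blast
  then show "S x = sqrt_op x" by (simp add: y_def)
qed

lemma operator_sqrt_eq: "operator_sqrt (\<lambda>x. x - X x) = sqrt_op"
  unfolding operator_sqrt_def
proof (rule the_equality)
  show "positive_operator sqrt_op \<and> sqrt_op \<circ> sqrt_op = (\<lambda>x. x - X x)"
    by (simp add: positive_sqrt_op fun_eq_iff sqrt_op_sqrt_op)
  show "S = sqrt_op" if "positive_operator S \<and> S \<circ> S = (\<lambda>x. x - X x)" for S
    using that by (intro sqrt_op_unique) (auto simp: fun_eq_iff)
qed

end

section \<open>Defect operator and the equation D v = c\<close>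

lemma
  fixes A :: "'a::complex_hilbert_space \<Rightarrow> 'a"
  assumes A: "bounded_clinear A" and le: "onorm A \<le> 1"
  shows positive_defect_operator: "positive_operator (defect_operator A)"
    and cinner_defect_operator:
      "cinner (defect_operator A x) (defect_operator A y) = cinner x y - cinner (A x) (A y)"
proof -
  note lin = bounded_clinearD[OF A]
  have adj: "cinner z (cadjoint A y) = cinner (A z) y" for y z by (simp add: cinner_cadjoint[OF A])
  have contr: "norm (A x) \<le> norm x" for x
    using onorm[OF lin(1), of x] mult_right_mono[OF le, of "norm x"] by simp
  interpret selfadjoint_contraction "\<lambda>x. cadjoint A (A x)"
  proof
    fix x y :: 'a and c
    show "cadjoint A (A (x + y)) = cadjoint A (A x) + cadjoint A (A y)"
      by (rule cinner_ext) (simp add: adj lin E.ip_simps)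
    show "cadjoint A (A (c *\<^sub>C x)) = c *\<^sub>C cadjoint A (A x)"
      by (rule cinner_ext) (simp add: adj lin E.ip_simps)
    show "cinner (cadjoint A (A x)) y = cinner x (cadjoint A (A y))"
      using cinner_commute[of "cadjoint A (A x)" y] cinner_commute[of "A y" "A x"] by (simp add: adj)
    let ?z = "cadjoint A (A x)"
    have "(norm ?z)\<^sup>2 = Re (cinner (A ?z) (A x))"
      by (simp add: E.nrm_sq adj)
    also have "\<dots> \<le> norm (A ?z) * norm (A x)"
      using cmod_cinner_le complex_Re_le_cmod order_trans by blast
    also have "\<dots> \<le> norm ?z * norm x" by (intro mult_mono contr) auto
    finally show "norm ?z \<le> norm x"
      by (cases "norm ?z = 0") (auto simp: power2_eq_square)
  qed
  have D: "defect_operator A = sqrt_op" unfolding defect_operator_def by (rule operator_sqrt_eq)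
  show pos: "positive_operator (defect_operator A)" by (simp add: D positive_sqrt_op)
  have sq: "defect_operator A (defect_operator A x) = x - cadjoint A (A x)" for x
    by (simp add: D sqrt_op_sqrt_op)
  have "cinner (defect_operator A x) (defect_operator A y) = cinner x (defect_operator A (defect_operator A y))"
    by (rule positive_operator_symmetric[OF pos])
  then show "cinner (defect_operator A x) (defect_operator A y) = cinner x y - cinner (A x) (A y)"
    by (simp add: sq E.ip_simps adj)
qed

text \<open>The bound makes \<open>D z \<mapsto> cinner z c\<close> a well-defined functional on the
  range of \<open>D\<close>, closed or not. Riesz yields \<open>v\<close> with
  \<open>cinner (D z) v = cinner z c\<close>, and symmetry moves \<open>D\<close> to
  \<open>v\<close>.\<close>

lemma mem_range_of_functional_bound:
  fixes D :: "'a::complex_hilbert_space \<Rightarrow> 'a"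
  assumes D: "positive_operator D" and C: "0 \<le> C"
    and bound: "\<And>z. cmod (cinner z c) \<le> C * norm (D z)"
  shows "\<exists>v. c = D v \<and> norm v \<le> C"
proof -
  let ?G = "{(D z, cinner z c) | z. True}"
  note lin = bounded_clinearD[OF positive_operator_clinear[OF D]]
  have "\<exists>v\<in>UNIV. norm v \<le> C \<and> (\<forall>(u, l)\<in>?G. cinner u v = l)"
  proof (rule E.riesz)
    fix u l v m assume "(u, l) \<in> ?G" "(v, m) \<in> ?G"
    then obtain y z where "u = D y" "l = cinner y c" "v = D z" "m = cinner z c" by blast
    then show "(u + v, l + m) \<in> ?G"
      by (auto simp: lin cinner_add_left intro!: exI[of _ "y + z"])
  next
    fix u l s assume "(u, l) \<in> ?G"
    then obtain y where "u = D y" "l = cinner y c" by blast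
    then show "(s *\<^sub>C u, s * l) \<in> ?G"
      by (auto simp: lin cinner_scaleC_left intro!: exI[of _ "s *\<^sub>C y"])
  qed (use C bound in auto)
  then obtain v where v: "norm v \<le> C" "\<And>z. cinner (D z) v = cinner z c" by auto
  have "c = D v"
    by (rule cinner_ext) (metis v(2) positive_operator_symmetric[OF D])
  then show ?thesis using v by blast
qed

text \<open>Each solution \<open>u\<close> bounds the functional by
  \<open>norm (D z) * norm u\<close>, so the infimum \<open>C\<close> of these norms is again a
  valid constant and the range criterion attains it. Uniqueness is the parallelogram law at the
  midpoint of two solutions.\<close>

lemma ex1_min_norm_preimage:
  fixes D :: "'a::complex_hilbert_space \<Rightarrow> 'a"
  assumes D: "positive_operator D" and c: "c \<in> range D"
  shows "\<exists>!v. is_arg_min norm (\<lambda>u. c = D u) v"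
proof -
  note lin = bounded_clinearD[OF positive_operator_clinear[OF D]]
  define U where "U = {u. c = D u}"
  have "U \<noteq> {}" using c by (auto simp: U_def)
  define C where "C = Inf (norm ` U)"
  have bdd: "bdd_below (norm ` U)" by (rule bdd_belowI2[of _ 0]) simp
  have C_le: "C \<le> norm u" if "u \<in> U" for u
    unfolding C_def using bdd that by (rule cINF_lower)
  have C0: "0 \<le> C" unfolding C_def using \<open>U \<noteq> {}\<close> by (intro cINF_greatest) auto
  have le: "cmod (cinner z c) \<le> norm (D z) * norm u" if "u \<in> U" for u z
  proof -
    have "cinner z c = cinner (D z) u"
      using that positive_operator_symmetric[OF D, of z u] by (simp add: U_def)
    then show ?thesis by (simp add: cmod_cinner_le)
  qed
  have "cmod (cinner z c) \<le> C * norm (D z)" for z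
  proof (cases "D z = 0")
    case True
    obtain u where "u \<in> U" using \<open>U \<noteq> {}\<close> by blast
    then show ?thesis using le[of u z] True by simp
  next
    case False
    have "cmod (cinner z c) / norm (D z) \<le> C"
      unfolding C_def using \<open>U \<noteq> {}\<close>
      by (rule cINF_greatest) (use le[of _ z] False in \<open>simp add: divide_simps mult.commute\<close>)
    then show ?thesis using False by (simp add: divide_simps split: if_splits)
  qed
  then obtain v where v: "c = D v" "norm v \<le> C"
    using mem_range_of_functional_bound[OF D C0] by blast
  show ?thesis
  proof (rule ex1I[of _ v])
    show "is_arg_min norm (\<lambda>u. c = D u) v"
      using v C_le by (force simp: is_arg_min_def U_def)
    fix w assume w: "is_arg_min norm (\<lambda>u. c = D u) w"
    then have "w \<in> U" by (simp add: is_arg_min_def U_def)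
    have "norm w \<le> C" using w v by (force simp: is_arg_min_def)
    have "c = D ((1/2) *\<^sub>R (w + v))"
      using v \<open>w \<in> U\<close> by (simp add: lin U_def flip: scaleR_2)
    then have "C \<le> norm ((1/2) *\<^sub>R (w + v))" by (intro C_le) (simp add: U_def)
    then have "(2 * C)\<^sup>2 \<le> (norm (w + v))\<^sup>2" using C0 by (intro power_mono) auto
    moreover have "(norm w)\<^sup>2 \<le> C\<^sup>2" "(norm v)\<^sup>2 \<le> C\<^sup>2"
      using \<open>norm w \<le> C\<close> v(2) by (auto intro: power_mono)
    ultimately have "(norm (w - v))\<^sup>2 \<le> 0"
      using E.parallelogram[of w v] by (simp add: power_mult_distrib)
    then show "w = v" by simp
  qed
qed

section \<open>Composition operators on reproducing kernel Hilbert spaces\<close>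

text \<open>Serves to add kernel combinations over different finite sets, extending coefficients by
  0 to the union.\<close>

lemma sum_Un_restrict:
  fixes f :: "'b \<Rightarrow> 'c::comm_monoid_add"
  assumes "finite S" "finite T"
  shows "(\<Sum>x\<in>S \<union> T. if x \<in> S then f x else 0) = sum f S"
    "(\<Sum>x\<in>S \<union> T. if x \<in> T then f x else 0) = sum f T"
  by (rule sum.mono_neutral_cong_right; use assms in simp)+

sublocale reproducing_kernel_hilbert_space \<subseteq> hs: hilbert_subspace "\<lambda>c f x. c * f x" H ip
  rewrites "hilbert_subspace.nrm ip = ip_norm ip"
proof -
  have vs: "vector_space (\<lambda>c (f :: 'x \<Rightarrow> complex) x. c * f x)"
    by unfold_locales (auto simp: fun_eq_iff algebra_simps)
  interpret vector_space "\<lambda>c (f :: 'x \<Rightarrow> complex) x. c * f x" by (rule vs)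
  show "hilbert_subspace (\<lambda>c f x. c * f x) H ip"
  proof unfold_locales
    show "subspace H"
      using zero_mem add_mem scale_mem
      by (auto simp: subspace_def zero_fun_def plus_fun_def)
    show "f = 0" if "f \<in> H" "ip f f = 0" for f
      using ip_definite[OF that] by (simp add: zero_fun_def)
    fix X :: "nat \<Rightarrow> 'x \<Rightarrow> complex"
    assume "\<And>n. X n \<in> H"
      and "\<And>e. e > 0 \<Longrightarrow> \<exists>N. \<forall>m\<ge>N. \<forall>n\<ge>N. sqrt (Re (ip (X m - X n) (X m - X n))) < e"
    then show "\<exists>p\<in>H. (\<lambda>n. sqrt (Re (ip (X n - p) (X n - p)))) \<longlonglongrightarrow> 0"
      using complete[of X] by (simp add: ip_norm_def fun_diff_def)
  qed (auto simp: plus_fun_def ip_add_left ip_scale_left ip_nonneg intro: ip_commute)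
  then interpret hilbert_subspace "\<lambda>c f x. c * f x" H ip .
  show "hilbert_subspace.nrm ip = ip_norm ip"
    by (simp add: fun_eq_iff nrm_def ip_norm_def)
qed

section \<open>Finite kernel combinations and membership in H\<close>

context reproducing_kernel_hilbert_space
begin

abbreviation kernel :: "'x \<Rightarrow> 'x \<Rightarrow> complex"
  where "kernel w \<equiv> \<lambda>z. K z w"

lemma ip_kernel_kernel: "ip (kernel v) (kernel w) = K w v"
  using reproducing[OF kernel_mem, of w v] by (rule sym)

lemma ip_kernel_left: "f \<in> H \<Longrightarrow> ip (kernel w) f = cnj (f w)"
  by (simp only: ip_commute[OF kernel_mem, of f w] reproducing[symmetric])

text \<open>The nodes \<open>x i\<close> may coincide. For \<open>x = \<phi>\<close> this is the
  image of \<open>kernel_comb S c id\<close> under the formal adjoint of composition,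
  \<open>kernel w \<mapsto> kernel (\<phi> w)\<close>.\<close>

definition kernel_comb :: "'b set \<Rightarrow> ('b \<Rightarrow> complex) \<Rightarrow> ('b \<Rightarrow> 'x) \<Rightarrow> 'x \<Rightarrow> complex"
  where "kernel_comb S c x = (\<Sum>i\<in>S. (\<lambda>z. c i * K z (x i)))"

lemma kernel_comb_mem: "kernel_comb S c x \<in> H"
  unfolding kernel_comb_def by (intro hs.mem_sum scale_mem kernel_mem)

lemma ip_kernel_comb:
  assumes "f \<in> H"
  shows "ip (kernel_comb S c x) f = (\<Sum>i\<in>S. c i * cnj (f (x i)))"
  unfolding kernel_comb_def
  using assms by (simp add: hs.ip_sum_left scale_mem kernel_mem ip_scale_left ip_kernel_left)

text \<open>The indices in \<open>K\<close> are swapped because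
  \<open>ip (kernel v) (kernel w) = K w v\<close>.\<close>

lemma ip_norm_kernel_comb_sq:
  "(ip_norm ip (kernel_comb S c x))\<^sup>2 = Re (\<Sum>i\<in>S. \<Sum>j\<in>S. c i * cnj (c j) * K (x j) (x i))"
proof -
  have "ip (kernel (x i)) (kernel_comb S c x) = (\<Sum>j\<in>S. cnj (c j) * K (x j) (x i))" for i
    unfolding kernel_comb_def
    by (simp add: hs.ip_sum_right scale_mem kernel_mem hs.ip_scale_right ip_kernel_kernel)
  then have "cnj (kernel_comb S c x (x i)) = (\<Sum>j\<in>S. cnj (c j) * K (x j) (x i))" for i
    by (simp only: ip_kernel_left[OF kernel_comb_mem])
  then show ?thesis
    by (simp add: hs.nrm_sq kernel_comb_mem ip_kernel_comb sum_distrib_left mult.assoc)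
qed

text \<open>The hypothesis bounds the functional sending \<open>kernel w\<close> to
  \<open>cnj (g w)\<close> on the span of the kernels; by the reproducing property its Riesz vector
  agrees with \<open>g\<close> pointwise.\<close>

lemma mem_of_kernel_comb_bound:
  assumes C: "0 \<le> C"
    and bound: "\<And>S c. finite S \<Longrightarrow> cmod (\<Sum>w\<in>S. c w * cnj (g w)) \<le> C * ip_norm ip (kernel_comb S c id)"
  shows "g \<in> H \<and> ip_norm ip g \<le> C"
proof -
  let ?G = "{(kernel_comb S c id, \<Sum>w\<in>S. c w * cnj (g w)) | S c. finite S}"
  have "\<exists>v\<in>H. ip_norm ip v \<le> C \<and> (\<forall>(u, l)\<in>?G. ip u v = l)"
  proof (rule hs.riesz)
    fix u l v m assume "(u, l) \<in> ?G" "(v, m) \<in> ?G"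
    then obtain S c T d where fin: "finite S" "finite T"
      and eqs: "u = kernel_comb S c id" "l = (\<Sum>w\<in>S. c w * cnj (g w))"
        "v = kernel_comb T d id" "m = (\<Sum>w\<in>T. d w * cnj (g w))" by blast
    let ?e = "\<lambda>w. (if w \<in> S then c w else 0) + (if w \<in> T then d w else 0)"
    have "(\<lambda>z. ?e w * K z w) = (if w \<in> S then (\<lambda>z. c w * K z w) else 0) + (if w \<in> T then (\<lambda>z. d w * K z w) else 0)"
      for w by (auto simp: fun_eq_iff algebra_simps)
    then have "u + v = kernel_comb (S \<union> T) ?e id"
      using fin by (simp add: eqs kernel_comb_def sum.distrib sum_Un_restrict)
    moreover have "?e w * cnj (g w) = (if w \<in> S then c w * cnj (g w) else 0) + (if w \<in> T then d w * cnj (g w) else 0)"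
      for w by (auto simp: algebra_simps)
    then have "l + m = (\<Sum>w\<in>S \<union> T. ?e w * cnj (g w))"
      using fin by (simp add: eqs sum.distrib sum_Un_restrict)
    ultimately show "(u + v, l + m) \<in> ?G" using fin by blast
  next
    fix u l s assume "(u, l) \<in> ?G"
    then obtain S c where fin: "finite S"
      and eqs: "u = kernel_comb S c id" "l = (\<Sum>w\<in>S. c w * cnj (g w))" by blast
    have "(\<lambda>z. s * u z) = kernel_comb S (\<lambda>w. s * c w) id"
      using hs.scale_sum_right[of s "\<lambda>w z. c w * K z (id w)" S]
      by (simp only: eqs kernel_comb_def mult.assoc)
    moreover have "s * l = (\<Sum>w\<in>S. (s * c w) * cnj (g w))"
      by (simp add: eqs sum_distrib_left mult.assoc)
    ultimately show "((\<lambda>z. s * u z), s * l) \<in> ?G"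
      using fin by (auto intro!: exI[of _ S] exI[of _ "\<lambda>w. s * c w"])
  qed (use C bound kernel_comb_mem in auto)
  then obtain v where v: "v \<in> H" "ip_norm ip v \<le> C" and all: "\<forall>(u, l)\<in>?G. ip u v = l"
    by (elim bexE conjE) (rule that)
  have rep: "ip (kernel_comb S c id) v = (\<Sum>w\<in>S. c w * cnj (g w))" if "finite S" for S c
  proof -
    have "(kernel_comb S c id, \<Sum>w\<in>S. c w * cnj (g w)) \<in> ?G" using that by blast
    from bspec[OF all this] show ?thesis by simp
  qed
  have "v w = g w" for w
    using rep[of "{w}" "\<lambda>_. 1"] v by (simp add: ip_kernel_comb)
  then have "v = g" by (rule ext)
  then show ?thesis using v by simp
qed

text \<open>Pairing kernels with \<open>f \<circ> \<phi>\<close> amounts to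
  \<open>ip (kernel_comb S c \<phi>) f\<close>, so an estimate for the formal adjoint on finite
  combinations suffices.\<close>

lemma composition_bound:
  assumes M: "0 \<le> M" and f: "f \<in> H"
    and bound: "\<And>S c. finite S \<Longrightarrow>
        ip_norm ip (kernel_comb S c \<phi>) \<le> M * ip_norm ip (kernel_comb S c id)"
  shows "f \<circ> \<phi> \<in> H \<and> ip_norm ip (f \<circ> \<phi>) \<le> M * ip_norm ip f"
proof (rule mem_of_kernel_comb_bound)
  fix S :: "'x set" and c :: "'x \<Rightarrow> complex" assume S: "finite S"
  have "cmod (\<Sum>w\<in>S. c w * cnj ((f \<circ> \<phi>) w)) \<le> ip_norm ip (kernel_comb S c \<phi>) * ip_norm ip f"
    using hs.cauchy_schwarz[OF kernel_comb_mem f, of S c \<phi>] by (simp add: ip_kernel_comb f)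
  also have "\<dots> \<le> (M * ip_norm ip (kernel_comb S c id)) * ip_norm ip f"
    using bound[OF S] f by (intro mult_right_mono) auto
  finally show "cmod (\<Sum>w\<in>S. c w * cnj ((f \<circ> \<phi>) w)) \<le> M * ip_norm ip f * ip_norm ip (kernel_comb S c id)"
    by (simp add: mult_ac)
qed (use M f in auto)

end

section \<open>The Segal-Bargmann space\<close>

locale segal_bargmann =
  reproducing_kernel_hilbert_space H ip "\<lambda>z w. exp (cinner z w)"
  for H :: "('a::complex_hilbert_space \<Rightarrow> complex) set"
    and ip :: "('a \<Rightarrow> complex) \<Rightarrow> ('a \<Rightarrow> complex) \<Rightarrow> complex"
begin

section \<open>Upper bound for affine symbols, growth of the symbol, lower bound\<close>

lemma ip_norm_kernel: "ip_norm ip (kernel w) = exp ((norm w)\<^sup>2 / 2)"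
proof -
  have "(ip_norm ip (kernel w))\<^sup>2 = (exp ((norm w)\<^sup>2 / 2))\<^sup>2"
    by (simp add: hs.nrm_sq kernel_mem ip_kernel_kernel E.ip_self Re_exp del: of_real_power
        flip: exp_double)
  then show ?thesis by (simp add: kernel_mem)
qed

text \<open>
  With \<open>\<psi> z = D z - v\<close> one has \<open>\<langle>\<phi> z, \<phi> w\<rangle> + \<langle>\<psi> z, \<psi> w\<rangle> = \<langle>z, w\<rangle> + \<parallel>v\<parallel>\<^sup>2 + \<parallel>b\<parallel>\<^sup>2\<close>, so that the kernel
  \<open>M\<^sup>2 K - K \<circ> \<phi>\<close> is the Schur product of \<open>K \<circ> \<phi>\<close> with \<open>exp \<langle>\<psi> z, \<psi> w\<rangle> - 1\<close>; the latter is the Gram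
  kernel of the differences \<open>K(\<cdot>, \<psi> z) - K(\<cdot>, 0)\<close>.
\<close>

lemma affine_composition_bound:
  assumes A: "bounded_clinear A" "onorm A \<le> 1" and \<phi>: "\<And>z. \<phi> z = A z + b"
    and v: "cadjoint A b = defect_operator A v" and f: "f \<in> H"
  shows "f \<circ> \<phi> \<in> H \<and> ip_norm ip (f \<circ> \<phi>) \<le> exp (1/2 * (norm v)\<^sup>2 + 1/2 * (norm b)\<^sup>2) * ip_norm ip f"
proof -
  define M where "M = exp (1/2 * (norm v)\<^sup>2 + 1/2 * (norm b)\<^sup>2)"
  let ?D = "defect_operator A"
  note D = positive_defect_operator[OF A]
  define \<psi> where "\<psi> z = ?D z - v" for z
  have key: "cinner (\<phi> z) (\<phi> w) + cinner (\<psi> z) (\<psi> w) = cinner z w + of_real ((norm v)\<^sup>2 + (norm b)\<^sup>2)"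
    for z w
  proof -
    \<comment> \<open>Both sides equal \<open>cinner z (cadjoint A b)\<close>; hence the mixed terms
      of \<open>\<phi>\<close> and \<open>\<psi>\<close> cancel.\<close>
    have "cinner (?D z) v = cinner (A z) b" for z
      using positive_operator_symmetric[OF D, of z v] cinner_cadjoint[OF A(1), of z b] v by simp
    then have "cinner (?D z) v = cinner (A z) b" "cinner v (?D w) = cinner b (A w)"
      using cinner_commute by metis+
    then show ?thesis
      by (simp add: \<phi> \<psi>_def E.ip_simps cinner_defect_operator[OF A] E.ip_self)
  qed
  have "ip_norm ip (kernel_comb S c \<phi>) \<le> M * ip_norm ip (kernel_comb S c id)" if S: "finite S" for S c
  proof -
    \<comment> \<open>The arguments are swapped so that the quadratic form of \<open>a\<close> is
      the squared norm of \<open>kernel_comb S c \<phi>\<close>.\<close>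
    define a where "a i j = exp (cinner (\<phi> j) (\<phi> i))" for i j
    define g where "g i = kernel (\<psi> i) - kernel 0" for i
    have gH: "g i \<in> H" for i unfolding g_def by (intro hs.mem_simps kernel_mem)
    have gg: "ip (g i) (g j) = exp (cinner (\<psi> j) (\<psi> i)) - 1" for i j
      unfolding g_def
      by (simp only: hs.ip_diff_left hs.ip_diff_right hs.mem_simps kernel_mem ip_kernel_kernel)
        (simp add: E.ip_simps)
    have a_psd: "0 \<le> Re (\<Sum>i\<in>S. \<Sum>j\<in>S. c i * cnj (c j) * a i j)" for c
      unfolding a_def ip_norm_kernel_comb_sq[symmetric] by simp
    have entry: "a i j * ip (g i) (g j) = of_real (M\<^sup>2) * exp (cinner j i) - exp (cinner (\<phi> j) (\<phi> i))" for i j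
    proof -
      have "a i j * exp (cinner (\<psi> j) (\<psi> i)) = exp (cinner j i + of_real ((norm v)\<^sup>2 + (norm b)\<^sup>2))"
        by (simp add: a_def key flip: exp_add)
      also have "\<dots> = exp (of_real ((norm v)\<^sup>2 + (norm b)\<^sup>2)) * exp (cinner j i)"
        by (simp add: exp_add)
      also have "exp (of_real ((norm v)\<^sup>2 + (norm b)\<^sup>2)) = (of_real (M\<^sup>2) :: complex)"
        by (simp only: M_def exp_of_real flip: exp_double) simp
      finally show ?thesis by (simp add: gg a_def algebra_simps)
    qed
    have "0 \<le> Re (\<Sum>i\<in>S. \<Sum>j\<in>S. c i * cnj (c j) *
        (of_real (M\<^sup>2) * exp (cinner j i) - exp (cinner (\<phi> j) (\<phi> i))))"
      using hs.schur_product[where f=g, OF S a_psd gH, of c] by (simp only: entry)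
    also have "(\<Sum>i\<in>S. \<Sum>j\<in>S. c i * cnj (c j) * (of_real (M\<^sup>2) * exp (cinner j i) - exp (cinner (\<phi> j) (\<phi> i))))
        = of_real (M\<^sup>2) * (\<Sum>i\<in>S. \<Sum>j\<in>S. c i * cnj (c j) * exp (cinner j i))
          - (\<Sum>i\<in>S. \<Sum>j\<in>S. c i * cnj (c j) * exp (cinner (\<phi> j) (\<phi> i)))"
      by (simp add: sum_distrib_left sum_subtractf right_diff_distrib mult_ac)
    also have "Re \<dots> = M\<^sup>2 * (ip_norm ip (kernel_comb S c id))\<^sup>2 - (ip_norm ip (kernel_comb S c \<phi>))\<^sup>2"
      unfolding ip_norm_kernel_comb_sq by (simp del: Re_sum of_real_power)
    finally have "(ip_norm ip (kernel_comb S c \<phi>))\<^sup>2 \<le> (M * ip_norm ip (kernel_comb S c id))\<^sup>2"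
      by (simp add: power_mult_distrib)
    then show ?thesis
      by (rule power2_le_imp_le) (simp add: kernel_comb_mem M_def)
  qed
  then show ?thesis
    using composition_bound[OF _ f, of M \<phi>] by (simp add: M_def)
qed

text \<open>The test function is \<open>kernel (\<phi> z)\<close>: the reproducing property bounds
  its composite at \<open>z\<close> by \<open>N\<close> times the norms of
  \<open>kernel (\<phi> z)\<close> and \<open>kernel z\<close>, and one exponential factor
  cancels.\<close>

lemma norm_symbol_le:
  assumes bound: "\<And>f. f \<in> H \<Longrightarrow> f \<circ> \<phi> \<in> H \<and> ip_norm ip (f \<circ> \<phi>) \<le> N * ip_norm ip f"
  shows "0 < N" "(norm (\<phi> z))\<^sup>2 \<le> (norm z)\<^sup>2 + 2 * ln N"
proof -
  have exp_le: "exp ((norm (\<phi> z))\<^sup>2 / 2) \<le> N * exp ((norm z)\<^sup>2 / 2)" for z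
  proof -
    let ?f = "kernel (\<phi> z)"
    note f = bound[OF kernel_mem, of "\<phi> z"]
    have "exp ((norm (\<phi> z))\<^sup>2 / 2) * exp ((norm (\<phi> z))\<^sup>2 / 2) = exp ((norm (\<phi> z))\<^sup>2)"
      by (simp flip: exp_add)
    also have "\<dots> = cmod ((?f \<circ> \<phi>) z)" by (simp add: E.ip_self)
    also have "(?f \<circ> \<phi>) z = ip (?f \<circ> \<phi>) (kernel z)" by (rule reproducing, rule conjunct1[OF f])
    also have "cmod \<dots> \<le> ip_norm ip (?f \<circ> \<phi>) * ip_norm ip (kernel z)"
      using f kernel_mem by (intro hs.cauchy_schwarz) auto
    also have "\<dots> \<le> (N * exp ((norm (\<phi> z))\<^sup>2 / 2)) * exp ((norm z)\<^sup>2 / 2)"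
      using f unfolding ip_norm_kernel by (intro mult_right_mono) auto
    finally have "exp ((norm (\<phi> z))\<^sup>2 / 2) * exp ((norm (\<phi> z))\<^sup>2 / 2)
        \<le> exp ((norm (\<phi> z))\<^sup>2 / 2) * (N * exp ((norm z)\<^sup>2 / 2))" by (simp add: mult_ac)
    then show ?thesis by simp
  qed
  have "0 < N * exp ((norm 0 :: real)\<^sup>2 / 2)"
    using less_le_trans[OF exp_gt_zero exp_le[of 0]] by simp
  then show N: "0 < N" by simp
  have "exp ((norm (\<phi> z))\<^sup>2 / 2) \<le> exp (ln N + (norm z)\<^sup>2 / 2)"
    using exp_le[of z] N by (simp add: exp_add)
  then show "(norm (\<phi> z))\<^sup>2 \<le> (norm z)\<^sup>2 + 2 * ln N" by simp
qed

lemma affine_composition_lower_bound: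
  assumes A: "bounded_clinear A" "onorm A \<le> 1" and \<phi>: "\<And>z. \<phi> z = A z + b"
    and bound: "\<And>f. f \<in> H \<Longrightarrow> f \<circ> \<phi> \<in> H \<and> ip_norm ip (f \<circ> \<phi>) \<le> N * ip_norm ip f"
  shows "\<exists>v. cadjoint A b = defect_operator A v \<and> exp (1/2 * (norm v)\<^sup>2 + 1/2 * (norm b)\<^sup>2) \<le> N"
proof -
  let ?D = "defect_operator A" and ?c = "cadjoint A b"
  note N = norm_symbol_le[OF bound, simplified]
  note linA = bounded_clinearD[OF A(1)]
  note linD = bounded_clinearD[OF positive_operator_clinear[OF positive_defect_operator[OF A]]]
  define R where "R = 2 * ln N - (norm b)\<^sup>2"
  \<comment> \<open>The growth bound for \<open>A z + b\<close>, expanded, with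
    \<open>(norm z)^2 - (norm (A z))^2\<close> rewritten as \<open>(norm (?D z))^2\<close>.\<close>
  have ineq: "2 * Re (cinner z ?c) \<le> (norm (?D z))\<^sup>2 + R" for z
  proof -
    have "(norm (?D z))\<^sup>2 = (norm z)\<^sup>2 - (norm (A z))\<^sup>2"
      using cinner_defect_operator[OF A, of z z] by (simp add: E.nrm_sq)
    moreover have "(norm (A z + b))\<^sup>2 = (norm (A z))\<^sup>2 + (norm b)\<^sup>2 + 2 * Re (cinner z ?c)"
      using E.nrm_sq[of "A z + b"] cinner_commute[of b "A z"] cinner_cadjoint[OF A(1), of z b]
      by (simp add: E.nrm_sq E.ip_simps)
    ultimately show ?thesis using N(2)[of z] by (simp add: R_def \<phi>)
  qed
  have R: "0 \<le> R" using ineq[of 0] by (simp add: linD E.ip_simps)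
  have "cmod (cinner z ?c) \<le> sqrt R * norm (?D z)" for z
  proof -
    define m where "m = (cmod (cinner z ?c))\<^sup>2"
    define d where "d = (norm (?D z))\<^sup>2"
    \<comment> \<open>Scaling \<open>z\<close> by \<open>t * cnj (cinner z ?c)\<close> turns its
      pairing with \<open>?c\<close> into the real number \<open>t * m\<close>.\<close>
    have tineq: "2 * t * m \<le> t\<^sup>2 * m * d + R" for t :: real
    proof -
      let ?s = "of_real t * cnj (cinner z ?c)"
      have "cnj (cinner z ?c) * cinner z ?c = of_real m"
        by (simp only: m_def complex_norm_square mult.commute)
      then have "Re (cinner (?s *\<^sub>C z) ?c) = t * m"
        unfolding cinner_scaleC_left mult.assoc by simp
      moreover have "(norm (?D (?s *\<^sub>C z)))\<^sup>2 = t\<^sup>2 * m * d"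
        by (simp add: linD norm_scaleC norm_mult power_mult_distrib m_def d_def)
      ultimately show ?thesis using ineq[of "?s *\<^sub>C z"] by simp
    qed
    have "m \<le> R * d"
    proof (cases "d = 0")
      case True
      have "m = 0"
      proof (rule ccontr)
        assume "m \<noteq> 0"
        \<comment> \<open>With \<open>d = 0\<close>, this \<open>t\<close> would give
          \<open>2 * (R + 1) \<le> R\<close>.\<close>
        then show False using tineq[of "(R + 1) / m"] True R by simp
      qed
      then show ?thesis using True by simp
    next
      case False
      then have "d > 0" by (simp add: d_def)
      \<comment> \<open>At \<open>t = 1 / d\<close> the inequality reads
        \<open>2 * m / d \<le> m / d + R\<close>.\<close>
      then show ?thesis using tineq[of "1 / d"] by (simp add: field_simps power2_eq_square)
    qed
    then have "(cmod (cinner z ?c))\<^sup>2 \<le> (sqrt R * norm (?D z))\<^sup>2"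
      using R by (simp add: m_def d_def power_mult_distrib)
    then show ?thesis by (rule power2_le_imp_le) (use R in simp)
  qed
  then obtain v where v: "?c = ?D v" "norm v \<le> sqrt R"
    using mem_range_of_functional_bound[OF positive_defect_operator[OF A]] R by (metis real_sqrt_ge_zero)
  have "(norm v)\<^sup>2 \<le> (sqrt R)\<^sup>2" using v(2) by (intro power_mono) auto
  then have "1/2 * (norm v)\<^sup>2 + 1/2 * (norm b)\<^sup>2 \<le> ln N" using R by (simp add: R_def)
  then have "exp (1/2 * (norm v)\<^sup>2 + 1/2 * (norm b)\<^sup>2) \<le> N"
    using N(1) by (metis exp_le_cancel_iff exp_ln)
  then show ?thesis using v by blast
qed

section \<open>Holomorphy along complex lines and affinity of the symbol\<close>

text \<open>
  The difference quotients of \<open>t \<mapsto> K(\<cdot>, u + t w)\<close> form a Cauchy net in \<open>H\<close>, as their inner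
  products are elementary; the limit represents the derivative along the line for all \<open>f\<close> at once.
\<close>

lemma line_derivative:
  "\<exists>p\<in>H. \<forall>f\<in>H. ((\<lambda>t. f (u + t *\<^sub>C w)) has_field_derivative ip f p) (at 0)"
proof -
  define g where "g s = kernel (u + s *\<^sub>C w) - kernel u" for s
  \<comment> \<open>\<open>ip\<close> is conjugate linear in the second argument, so the factor
    \<open>1 / cnj s\<close> makes \<open>ip f (q s)\<close> the difference quotient of
    \<open>f\<close> with step \<open>s\<close>.\<close>
  define q where "q s = (\<lambda>z. (1 / cnj s) * g s z)" for s
  have gH: "g s \<in> H" for s unfolding g_def by (intro hs.mem_simps kernel_mem)
  have qH: "q s \<in> H" for s unfolding q_def by (rule scale_mem[OF gH])
  define \<alpha> \<beta> \<gamma> \<delta> where defs: "\<alpha> = cinner u u" "\<beta> = cinner w u" "\<gamma> = cinner u w" "\<delta> = cinner w w"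
  let ?d = "\<lambda>c t :: complex. (exp (c * t) - 1) / t"
  have d: "(?d c \<longlongrightarrow> c) (at 0)" for c
  proof -
    have "((\<lambda>t. exp (c * t)) has_field_derivative c) (at 0)"
      by (auto intro!: derivative_eq_intros)
    then show ?thesis by (simp add: DERIV_def)
  qed
  \<comment> \<open>This is \<open>x y z - x - y + 1 = (x - 1) (y - 1) + x y (z - 1)\<close> for the
    three exponentials; dividing by \<open>t * cnj s\<close> leaves difference quotients at 0 in
    \<open>t\<close>, \<open>cnj s\<close> and \<open>t * cnj s\<close>.\<close>
  have qq: "ip (q s) (q t) = exp \<alpha> * (?d \<beta> t * ?d \<gamma> (cnj s)
      + exp (\<beta> * t) * exp (\<gamma> * cnj s) * ?d \<delta> (t * cnj s))" for s t
  proof -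
    have "ip (q s) (q t) = (1 / cnj s) * (1 / t) * (exp (\<alpha> + \<beta> * t + \<gamma> * cnj s + \<delta> * (t * cnj s))
        - exp (\<alpha> + \<beta> * t) - exp (\<alpha> + \<gamma> * cnj s) + exp \<alpha>)"
    proof -
      have "ip (g s) (g t) = exp (cinner (u + t *\<^sub>C w) (u + s *\<^sub>C w)) - exp (cinner (u + t *\<^sub>C w) u)
          - exp (cinner u (u + s *\<^sub>C w)) + exp (cinner u u)"
        unfolding g_def
        by (simp only: hs.ip_diff_left hs.ip_diff_right hs.mem_simps kernel_mem ip_kernel_kernel) simp
      moreover have "ip (q s) (q t) = (1 / cnj s) * (1 / t) * ip (g s) (g t)"
        unfolding q_def
        by (simp only: ip_scale_left hs.ip_scale_right scale_mem gH) simp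
      moreover have "cinner (u + t *\<^sub>C w) (u + s *\<^sub>C w) = \<alpha> + \<beta> * t + \<gamma> * cnj s + \<delta> * (t * cnj s)"
        "cinner (u + t *\<^sub>C w) u = \<alpha> + \<beta> * t" "cinner u (u + s *\<^sub>C w) = \<alpha> + \<gamma> * cnj s"
        by (simp_all add: E.ip_simps defs algebra_simps)
      ultimately show ?thesis by (simp only: defs(1)[symmetric])
    qed
    moreover have "(1 / s') * (1 / t) * (e * x * y * z - e * x - e * y + e)
        = e * ((x - 1) / t * ((y - 1) / s') + x * y * ((z - 1) / (t * s')))" for e x y z s' :: complex
      by (cases "s' = 0 \<or> t = 0") (auto simp: field_simps)
    ultimately show ?thesis by (simp only: exp_add)
  qed
  let ?F = "at (0::complex) \<times>\<^sub>F at (0::complex)"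
  have "filterlim fst (at 0) ?F" and snd0: "filterlim snd (at 0) ?F"
    by (rule filterlim_fst filterlim_snd)+
  then have nz: "\<forall>\<^sub>F x in ?F. fst x \<noteq> 0" "\<forall>\<^sub>F x in ?F. snd x \<noteq> 0"
    and lim: "(fst \<longlongrightarrow> 0) ?F" "(snd \<longlongrightarrow> 0) ?F"
    by (simp_all add: filterlim_at)
  have cnj_lim: "((\<lambda>x. cnj (fst x)) \<longlongrightarrow> 0) ?F" using tendsto_cnj[OF lim(1)] by simp
  then have fst0: "filterlim (\<lambda>x. cnj (fst x)) (at 0) ?F"
    using nz(1) by (simp add: filterlim_at)
  have prod0: "filterlim (\<lambda>x. snd x * cnj (fst x)) (at 0) ?F"
  proof (rule filterlim_atI)
    show "((\<lambda>x. snd x * cnj (fst x)) \<longlongrightarrow> 0) ?F"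
      using tendsto_mult[OF lim(2) cnj_lim] by simp
    show "\<forall>\<^sub>F x in ?F. snd x * cnj (fst x) \<noteq> 0"
      using eventually_conj[OF nz] by eventually_elim simp
  qed
  have "((\<lambda>x. ip (q (fst x)) (q (snd x))) \<longlongrightarrow>
      exp \<alpha> * (\<beta> * \<gamma> + exp (\<beta> * 0) * exp (\<gamma> * 0) * \<delta>)) ?F"
    unfolding qq
    by (intro tendsto_intros lim(2) cnj_lim filterlim_compose[OF d snd0] filterlim_compose[OF d fst0]
        filterlim_compose[OF d prod0])
  then obtain p where p: "p \<in> H" "((\<lambda>s. ip_norm ip (q s - p)) \<longlongrightarrow> 0) (at 0)"
    using hs.tendsto_at_complete[of q, OF qH] by blast
  have "((\<lambda>t. f (u + t *\<^sub>C w)) has_field_derivative ip f p) (at 0)" if f: "f \<in> H" for f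
  proof -
    have "ip f (g s) = f (u + s *\<^sub>C w) - f u" for s
      unfolding g_def using f
      by (simp only: hs.ip_diff_right kernel_mem reproducing[OF f, symmetric])
    then have "ip f (q s) = (f (u + s *\<^sub>C w) - f u) / s" for s
      unfolding q_def by (simp only: hs.ip_scale_right f gH) simp
    then show ?thesis
      using hs.tendsto_ip_right[OF qH p(1) f p(2)] by (simp add: DERIV_def)
  qed
  then show ?thesis using p(1) by blast
qed

text \<open>The function is the vector \<open>p\<close> representing the derivative at 0 in
  direction \<open>a\<close>: testing on \<open>kernel z\<close> gives
  \<open>cnj (p z) = cinner a z\<close>.\<close>

lemma functional_mem: "(\<lambda>z. cinner z a) \<in> H"
proof -
  obtain p where p: "p \<in> H"
    and deriv: "\<And>f. f \<in> H \<Longrightarrow> ((\<lambda>t. f (0 + t *\<^sub>C a)) has_field_derivative ip f p) (at 0)"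
    using line_derivative[of 0 a] by blast
  have "p z = cinner z a" for z
  proof -
    have "((\<lambda>t. exp (t * cinner a z)) has_field_derivative ip (kernel z) p) (at 0)"
      using deriv[OF kernel_mem, of z] by (simp add: cinner_scaleC_left)
    moreover have "((\<lambda>t. exp (t * cinner a z)) has_field_derivative cinner a z) (at 0)"
      by (auto intro!: derivative_eq_intros)
    ultimately have "cnj (p z) = cinner a z"
      using DERIV_unique ip_kernel_left[OF p] by metis
    then show ?thesis by (metis cinner_commute complex_cnj_cnj)
  qed
  then have "p = (\<lambda>z. cinner z a)" by (rule ext)
  then show ?thesis using p by simp
qed

text \<open>Moving the base point to \<open>u + t0 *\<^sub>C w\<close> turns differentiability at
  \<open>t0\<close> into \<open>line_derivative\<close>.\<close>

lemma holomorphic_on_line: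
  assumes f: "f \<in> H"
  shows "(\<lambda>t. f (u + t *\<^sub>C w)) holomorphic_on UNIV"
proof -
  have "(\<lambda>t. f (u + t *\<^sub>C w)) field_differentiable at t0" for t0
  proof -
    obtain p where "((\<lambda>t. f ((u + t0 *\<^sub>C w) + t *\<^sub>C w)) has_field_derivative ip f p) (at 0)"
      using line_derivative[of "u + t0 *\<^sub>C w" w] f by blast
    then have "((\<lambda>t. f (u + (t + t0) *\<^sub>C w)) has_field_derivative ip f p) (at 0)"
      by (simp add: scaleC_add_left add_ac)
    then show ?thesis
      using DERIV_shift[of "\<lambda>t. f (u + t *\<^sub>C w)" _ 0 t0] by (auto simp: field_differentiable_def)
  qed
  then show ?thesis by (simp add: holomorphic_on_def field_differentiable_at_within)
qed

lemma symbol_affine_on_line: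
  assumes bound: "\<And>f. f \<in> H \<Longrightarrow> f \<circ> \<phi> \<in> H \<and> ip_norm ip (f \<circ> \<phi>) \<le> N * ip_norm ip f"
  shows "\<phi> (u + t *\<^sub>C w) = \<phi> u + t *\<^sub>C (\<phi> (u + w) - \<phi> u)"
proof -
  define L where "L = 2 * ln N"
  have growth: "(norm (\<phi> z))\<^sup>2 \<le> (norm z)\<^sup>2 + L" for z
    using norm_symbol_le(2)[OF bound] by (simp add: L_def)
  have L: "0 \<le> L" using order_trans[OF zero_le_power2 growth[of 0]] by simp
  have lin_growth: "norm (\<phi> z) \<le> norm z + sqrt L" for z
  proof (rule power2_le_imp_le)
    show "(norm (\<phi> z))\<^sup>2 \<le> (norm z + sqrt L)\<^sup>2"
      using growth[of z] L by (simp add: power2_sum add_increasing2)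
  qed (use L in simp)
  have line: "cinner (\<phi> (u + t *\<^sub>C w)) a = cinner (\<phi> u + t *\<^sub>C (\<phi> (u + w) - \<phi> u)) a" for a
  proof -
    define h where "h t = cinner (\<phi> (u + t *\<^sub>C w)) a" for t
    \<comment> \<open>Boundedness keeps this composite in \<open>H\<close>; that is what makes
      \<open>h\<close> entire.\<close>
    have "(\<lambda>z. cinner z a) \<circ> \<phi> \<in> H" using bound functional_mem by blast
    from holomorphic_on_line[OF this, of u w] have hol: "h holomorphic_on UNIV"
      by (simp add: h_def[abs_def])
    \<comment> \<open>For \<open>1 \<le> cmod s\<close> the constant terms are absorbed into
      multiples of \<open>cmod s\<close>, giving degree 1 in Liouville's theorem.\<close>
    have "cmod (h s) \<le> (norm a * (norm u + norm w + sqrt L)) * cmod s ^ 1" if "1 \<le> cmod s" for s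
    proof -
      have "cmod (h s) \<le> norm (\<phi> (u + s *\<^sub>C w)) * norm a" unfolding h_def by (rule cmod_cinner_le)
      also have "\<dots> \<le> ((norm u + cmod s * norm w) + sqrt L) * norm a"
        using lin_growth[of "u + s *\<^sub>C w"] norm_triangle_ineq[of u "s *\<^sub>C w"]
        by (intro mult_right_mono) (auto simp: norm_scaleC)
      also have "\<dots> \<le> ((cmod s * norm u + cmod s * norm w) + cmod s * sqrt L) * norm a"
        using that L mult_right_mono[of 1 "cmod s" "norm u"] mult_right_mono[of 1 "cmod s" "sqrt L"]
        by (intro mult_right_mono add_mono) auto
      finally show ?thesis by (simp add: algebra_simps)
    qed
    then have poly: "h s = (\<Sum>k\<le>1. (deriv ^^ k) h 0 / fact k * s ^ k)" for s
      by (rule Liouville_polynomial[OF hol])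
    have lin: "h s = h 0 + deriv h 0 * s" for s by (subst poly[of s]) simp
    have "h t = h 0 + t * (h 1 - h 0)"
      using lin[of t] lin[of 1] by (simp add: algebra_simps)
    then show ?thesis by (simp add: h_def scaleC_one E.ip_simps)
  qed
  show ?thesis by (rule cinner_ext) (metis line cinner_commute)
qed

lemma symbol_affine:
  assumes bound: "\<And>f. f \<in> H \<Longrightarrow> f \<circ> \<phi> \<in> H \<and> ip_norm ip (f \<circ> \<phi>) \<le> N * ip_norm ip f"
  shows "\<exists>A b. (\<forall>z. \<phi> z = A z + b) \<and> bounded_clinear A \<and> onorm A \<le> 1"
proof -
  define A where "A z = \<phi> z - \<phi> 0" for z
  note line = symbol_affine_on_line[OF bound]
  have scale: "A (c *\<^sub>C x) = c *\<^sub>C A x" for c x using line[of 0 c x] by (simp add: A_def)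
  have add: "A (x + y) = A x + A y" for x y
  proof -
    have half: "(1/2) *\<^sub>C z = (1/2) *\<^sub>R z" for z :: 'a by (simp add: scaleR_scaleC)
    \<comment> \<open>The midpoint of \<open>x\<close> and \<open>y\<close> is the parameter
      \<open>1/2\<close> on their line; homogeneity then turns midpoint affinity into
      additivity.\<close>
    have "\<phi> (x + (1/2) *\<^sub>C (y - x)) = \<phi> x + (1/2) *\<^sub>C (\<phi> y - \<phi> x)"
      using line[of x "1/2" "y - x"] by simp
    moreover have "x + (1/2) *\<^sub>C (y - x) = (1/2) *\<^sub>C (x + y)"
      unfolding half using scaleR_half_double[of x] by (simp add: algebra_simps)
    ultimately have "A ((1/2) *\<^sub>C (x + y)) = \<phi> x + (1/2) *\<^sub>C (\<phi> y - \<phi> x) - \<phi> 0"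
      by (simp only: A_def)
    also have "\<dots> = (1/2) *\<^sub>R (A x + A y)"
      unfolding half A_def using scaleR_half_double[of "\<phi> x"] scaleR_half_double[of "\<phi> 0"]
      by (simp add: algebra_simps)
    finally have "A ((1/2) *\<^sub>C (x + y)) = (1/2) *\<^sub>R (A x + A y)" .
    then have "(1/2) *\<^sub>R A (x + y) = (1/2) *\<^sub>R (A x + A y)"
      by (simp only: scale half[symmetric])
    then show ?thesis by simp
  qed
  have contr: "norm (A x) \<le> norm x" for x
  proof (rule field_le_epsilon)
    fix e :: real assume "e > 0"
    define L where "L = 2 * ln N"
    have growth: "(norm (\<phi> z))\<^sup>2 \<le> (norm z)\<^sup>2 + L" for z
      using norm_symbol_le(2)[OF bound] by (simp add: L_def)
    have L: "0 \<le> L" using order_trans[OF zero_le_power2 growth[of 0]] by simp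
    define B where "B = sqrt L + norm (\<phi> 0)"
    have B: "0 \<le> B" using L by (simp add: B_def)
    \<comment> \<open>This dilation gives \<open>B \<le> t * e\<close>; the summand 1 keeps
      \<open>t\<close> positive when \<open>B = 0\<close>.\<close>
    define t where "t = B / e + 1"
    have t: "t > 0" using B \<open>e > 0\<close> by (simp add: t_def add_nonneg_pos)
    have "(norm (\<phi> (t *\<^sub>R x)))\<^sup>2 \<le> (norm (t *\<^sub>R x) + sqrt L)\<^sup>2"
      using growth[of "t *\<^sub>R x"] L by (simp add: power2_sum add_increasing2)
    then have "norm (\<phi> (t *\<^sub>R x)) \<le> norm (t *\<^sub>R x) + sqrt L"
      by (rule power2_le_imp_le) (use L in simp)
    then have "norm (A (t *\<^sub>R x)) \<le> t * norm x + B"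
      using norm_triangle_ineq4[of "\<phi> (t *\<^sub>R x)" "\<phi> 0"] t by (simp add: A_def B_def)
    moreover have "norm (A (t *\<^sub>R x)) = t * norm (A x)"
      using t scale[of "of_real t" x] by (simp add: scaleR_scaleC norm_scaleC)
    moreover have "B \<le> t * e" using \<open>e > 0\<close> by (simp add: t_def field_simps)
    ultimately have "t * norm (A x) \<le> t * (norm x + e)" by (simp add: algebra_simps)
    then show "norm (A x) \<le> norm x + e" using t by simp
  qed
  have "\<forall>z. \<phi> z = A z + \<phi> 0" by (simp add: A_def)
  moreover have "bounded_clinear A" using add scale contr by (intro bounded_clinearI[where K=1]) auto
  moreover have "onorm A \<le> 1" using contr by (intro onorm_bound) auto
  ultimately show ?thesis by blast
qed

section \<open>Boundedness criterion and operator norm\<close>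

lemma bounded_operator_on_composition_iff:
  "bounded_operator_on H ip (composition_operator \<phi>) \<longleftrightarrow>
    (\<exists>M. \<forall>f\<in>H. f \<circ> \<phi> \<in> H \<and> ip_norm ip (f \<circ> \<phi>) \<le> M * ip_norm ip f)"
  \<comment> \<open>Linearity of composition holds pointwise, so only invariance of \<open>H\<close>
    and the norm bound remain.\<close>
  by (simp add: bounded_operator_on_def composition_operator_def comp_def) blast

text \<open>The minimal \<open>v\<close> gives the upper bound. The supremum \<open>N\<close> over
  the unit ball is itself a bound for composition, so the lower bound yields a solution
  \<open>v'\<close> whose exponential is at most \<open>N\<close>, and minimality compares
  \<open>v\<close> with \<open>v'\<close>.\<close>

lemma operator_norm_on_composition:
  assumes adm: "admissible_symbol \<phi> A b"
    and v: "is_arg_min norm (\<lambda>u. cadjoint A b = defect_operator A u) v"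
  shows "operator_norm_on H ip (composition_operator \<phi>) = exp (1/2 * (norm v)\<^sup>2 + 1/2 * (norm b)\<^sup>2)"
proof -
  let ?M = "exp (1/2 * (norm v)\<^sup>2 + 1/2 * (norm b)\<^sup>2)"
  let ?B = "{f \<in> H. ip_norm ip f \<le> 1}"
  have A: "bounded_clinear A" "onorm A \<le> 1" and \<phi>: "\<And>z. \<phi> z = A z + b"
    using adm by (auto simp: admissible_symbol_def)
  have upper: "f \<circ> \<phi> \<in> H \<and> ip_norm ip (f \<circ> \<phi>) \<le> ?M * ip_norm ip f" if "f \<in> H" for f
    using v by (intro affine_composition_bound[OF A \<phi> _ that]) (simp add: is_arg_min_def)
  define N where "N = (SUP f\<in>?B. ip_norm ip (f \<circ> \<phi>))"
  have le: "ip_norm ip (f \<circ> \<phi>) \<le> ?M" if "f \<in> ?B" for f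
  proof -
    have "ip_norm ip (f \<circ> \<phi>) \<le> ?M * ip_norm ip f" using upper that by blast
    also have "\<dots> \<le> ?M * 1" using that by (intro mult_left_mono) auto
    finally show ?thesis by simp
  qed
  have "0 \<in> ?B" using hs.mem_simps(1) hs.nrm_zero by simp
  then have "N \<le> ?M" unfolding N_def using le by (intro cSUP_least) auto
  have N: "ip_norm ip (f \<circ> \<phi>) \<le> N" if "f \<in> ?B" for f
    unfolding N_def using that le by (intro cSUP_upper bdd_aboveI2[of _ _ ?M]) auto
  have "f \<circ> \<phi> \<in> H \<and> ip_norm ip (f \<circ> \<phi>) \<le> N * ip_norm ip f" if f: "f \<in> H" for f
  proof (cases "ip_norm ip f = 0")
    case True
    then show ?thesis using upper[OF f] by auto
  next
    case False
    let ?r = "ip_norm ip f"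
    have r: "?r > 0" using False f hs.nrm_nonneg[OF f] by linarith
    let ?g = "\<lambda>x. of_real (1 / ?r) * f x"
    have "ip_norm ip ?g = 1"
      using hs.nrm_scale[OF f, of "of_real (1 / ?r)"] r by (simp add: norm_divide)
    then have "?g \<in> ?B" using scale_mem[OF f, of "of_real (1 / ?r)"]
      by (simp only: mem_Collect_eq order_refl simp_thms)
    from N[OF this] have "ip_norm ip (\<lambda>x. of_real (1 / ?r) * (f \<circ> \<phi>) x) \<le> N" by (simp add: comp_def)
    also have "ip_norm ip (\<lambda>x. of_real (1 / ?r) * (f \<circ> \<phi>) x) = ip_norm ip (f \<circ> \<phi>) / ?r"
      using hs.nrm_scale[OF conjunct1[OF upper[OF f]], of "of_real (1 / ?r)"] r by (simp add: norm_divide)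
    finally show ?thesis using r upper[OF f] by (simp add: divide_le_eq)
  qed
  then obtain v' where v': "cadjoint A b = defect_operator A v'"
    "exp (1/2 * (norm v')\<^sup>2 + 1/2 * (norm b)\<^sup>2) \<le> N"
    using affine_composition_lower_bound[OF A \<phi>] by blast
  have "norm v \<le> norm v'" using v v'(1) by (force simp: is_arg_min_def)
  then have "?M \<le> exp (1/2 * (norm v')\<^sup>2 + 1/2 * (norm b)\<^sup>2)" by (simp add: power_mono)
  then have "?M \<le> N" using v'(2) by linarith
  then have "N = ?M" using \<open>N \<le> ?M\<close> by linarith
  then show ?thesis by (simp add: operator_norm_on_def composition_operator_def N_def)
qed

end

theorem theorem1p3:
  fixes \<phi> :: "'a::complex_hilbert_space \<Rightarrow> 'a"
    and H :: "('a \<Rightarrow> complex) set"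
    and ip :: "('a \<Rightarrow> complex) \<Rightarrow> ('a \<Rightarrow> complex) \<Rightarrow> complex"
  assumes "segal_bargmann_space H ip"
  shows "(bounded_operator_on H ip (composition_operator \<phi>) \<longleftrightarrow>
           (\<exists>A b. admissible_symbol \<phi> A b)) \<and>
         (\<forall>A b. admissible_symbol \<phi> A b \<longrightarrow>
           (\<exists>!v. is_arg_min norm (\<lambda>u. cadjoint A b = defect_operator A u) v) \<and>
           (\<forall>v. is_arg_min norm (\<lambda>u. cadjoint A b = defect_operator A u) v \<longrightarrow>
             operator_norm_on H ip (composition_operator \<phi>) =
               exp (1 / 2 * (norm v)\<^sup>2 + 1 / 2 * (norm b)\<^sup>2)))"
proof -
  interpret segal_bargmann H ip
    using assms by (simp add: segal_bargmann_space_def segal_bargmann_def)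
  have "\<exists>A b. admissible_symbol \<phi> A b" if "bounded_operator_on H ip (composition_operator \<phi>)"
  proof -
    obtain N where N: "\<And>f. f \<in> H \<Longrightarrow> f \<circ> \<phi> \<in> H \<and> ip_norm ip (f \<circ> \<phi>) \<le> N * ip_norm ip f"
      using \<open>bounded_operator_on H ip (composition_operator \<phi>)\<close>
      unfolding bounded_operator_on_composition_iff by blast
    obtain A b where A: "\<And>z. \<phi> z = A z + b" "bounded_clinear A" "onorm A \<le> 1"
      using symbol_affine[OF N] by blast
    \<comment> \<open>From the lower bound only the solvability of the equation is taken, as the
      range condition.\<close>
    then show ?thesis
      using affine_composition_lower_bound[OF A(2,3,1) N] unfolding admissible_symbol_def by blast
  qed
  moreover have "bounded_operator_on H ip (composition_operator \<phi>)" if "admissible_symbol \<phi> A b" for A b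
    using that affine_composition_bound[of A \<phi> b]
    unfolding bounded_operator_on_composition_iff admissible_symbol_def by blast
  moreover have "\<exists>!v. is_arg_min norm (\<lambda>u. cadjoint A b = defect_operator A u) v"
    if "admissible_symbol \<phi> A b" for A b
    using that by (intro ex1_min_norm_preimage positive_defect_operator) (auto simp: admissible_symbol_def)
  ultimately show ?thesis using operator_norm_on_composition by blast
qed

end
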